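(* Fix integers $n,d\geq 2$, a two-dimensional linear subspace $W\subseteq\mathbb R^d$ equipped with a fixed orientation ("clockwise"), and $\gamma>0$. Let $a_1,\dots,a_n\in\mathbb R^d$ be independent random vectors, each having a probability density (continuous distribution). For $I\in\binom{[n]}{d}$ let $F_I=\operatorname{conv}(a_i:i\in I)$ and let $E_I$ be the event that $F_I$ is a facet of $\operatorname{conv}(a_1,\dots,a_n)$ and $F_I\cap W\neq\emptyset$. Conditional on $E_I$, let $y_I\in W$ be the outer unit normal (within $W$) of the edge $F_I\cap W$ of the polygon $\operatorname{conv}(a_1,\dots,a_n)\cap W$, write $F_I\cap W=[p_1,p_2]$ where $p_2$ is the second vertex of this edge in clockwise order, and let $p_3$ be the next vertex of $\operatorname{conv}(a_1,\dots,a_n)\cap W$ after the edge $F_I\cap W$ in clockwise order. Suppose that for every $I\in\binom{[n]}{d}$ with $\Pr[E_I]\geq 10\binom nd^{-1}$ we have \[ \Pr\big[y_I^\top p_2-y_I^\top p_3\geq\gamma \,\big|\, E_I\big]\geq 0.1 . \] Then \[ \mathbb E\big[\operatorname{edges}(\operatorname{conv}(a_1,\dots,a_n)\cap W)\big]\leq 10+80\pi\sqrt{\frac{\mathbb E[\max_{i\in[n]}\|\pi_W(a_i)\|]}{\gamma}} . \]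
   Context: $\pi_W$ is the orthogonal projection onto $W$, $\|\cdot\|$ the Euclidean norm, and $\operatorname{edges}(T)$ the number of edges of a polygon $T$. Clockwise order: if $q_1,\dots,q_k$ are the vertices of the polygon listed in the fixed clockwise orientation (indices mod $k$), then for the edge $[q_{i-1},q_i]$ the vertex $q_i$ is its second vertex in clockwise order and $q_{i+1}$ is the next vertex after that edge in clockwise order. *)

theory Defs
  imports "HOL-Probability.Probability"
begin

definition orth_proj :: "'a::euclidean_space set \<Rightarrow> 'a \<Rightarrow> 'a" where
  "orth_proj W x = (THE p. p \<in> W \<and> (\<forall>w\<in>W. orthogonal (x - p) w))"

text \<open>
  An orientation of a plane \<open>W\<close> is represented by an ordered orthonormal basis \<open>(u, v)\<close> of \<open>W\<close>;
  the rotation taking \<open>u\<close> to \<open>v\<close> by a quarter turn is the one called clockwise.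
\<close>

definition oriented_plane :: "'a::euclidean_space set \<Rightarrow> 'a \<Rightarrow> 'a \<Rightarrow> bool" where
  "oriented_plane W u v \<longleftrightarrow>
     subspace W \<and> dim W = 2 \<and>
     u \<in> W \<and> v \<in> W \<and> norm u = 1 \<and> norm v = 1 \<and> orthogonal u v"

definition clockwise_turn ::
  "'a::euclidean_space \<Rightarrow> 'a \<Rightarrow> 'a \<Rightarrow> 'a \<Rightarrow> 'a \<Rightarrow> bool" where
  "clockwise_turn u v p q r \<longleftrightarrow>
     ((q - p) \<bullet> u) * ((r - p) \<bullet> v) - ((q - p) \<bullet> v) * ((r - p) \<bullet> u) > 0"

text \<open>
  A list enumerates the vertices of a convex polygon once around in clockwise order (from an
  arbitrary starting vertex) iff each three of them, taken in list order, make a clockwise turn.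
\<close>

definition clockwise_vertices ::
  "'a::euclidean_space \<Rightarrow> 'a \<Rightarrow> 'a set \<Rightarrow> 'a list \<Rightarrow> bool" where
  "clockwise_vertices u v T qs \<longleftrightarrow>
     distinct qs \<and> set qs = {q. q extreme_point_of T} \<and>
     (\<forall>i j l. i < j \<and> j < l \<and> l < length qs \<longrightarrow>
        clockwise_turn u v (qs ! i) (qs ! j) (qs ! l))"

definition consecutive_vertices ::
  "'a::euclidean_space \<Rightarrow> 'a \<Rightarrow> 'a set \<Rightarrow> 'a \<Rightarrow> 'a \<Rightarrow> 'a \<Rightarrow> bool" where
  "consecutive_vertices u v T p1 p2 p3 \<longleftrightarrow>
     (\<exists>qs i. clockwise_vertices u v T qs \<and> i < length qs \<and>
        p1 = qs ! i \<and>
        p2 = qs ! ((i + 1) mod length qs) \<and>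
        p3 = qs ! ((i + 2) mod length qs))"

definition outer_unit_normal ::
  "'a::euclidean_space set \<Rightarrow> 'a set \<Rightarrow> 'a set \<Rightarrow> 'a \<Rightarrow> bool" where
  "outer_unit_normal W T e y \<longleftrightarrow>
     y \<in> W \<and> norm y = 1 \<and> (\<forall>z\<in>e. \<forall>x\<in>T. y \<bullet> x \<le> y \<bullet> z)"

definition edges :: "'a::euclidean_space set \<Rightarrow> nat" where
  "edges T = card {e. e edge_of T}"

definition facet_event ::
  "'a::euclidean_space set \<Rightarrow> nat \<Rightarrow> (nat \<Rightarrow> 'a) \<Rightarrow> nat set \<Rightarrow> bool" where
  "facet_event W n x I \<longleftrightarrow>
     (convex hull (x ` I)) facet_of (convex hull (x ` {1..n})) \<and>
     convex hull (x ` I) \<inter> W \<noteq> {}"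

text \<open>
  When \<open>facet_event W n x I\<close> holds and the points are in general position, \<open>y\<close>, \<open>p1\<close>, \<open>p2\<close>, \<open>p3\<close>
  below exist and are uniquely determined.
\<close>

definition next_vertex_gap ::
  "'a::euclidean_space set \<Rightarrow> 'a \<Rightarrow> 'a \<Rightarrow> nat \<Rightarrow> (nat \<Rightarrow> 'a) \<Rightarrow> nat set \<Rightarrow> real \<Rightarrow> bool" where
  "next_vertex_gap W u v n x I \<gamma> \<longleftrightarrow>
     (let T = convex hull (x ` {1..n}) \<inter> W; e = convex hull (x ` I) \<inter> W in
      \<exists>y p1 p2 p3. outer_unit_normal W T e y \<and> e = closed_segment p1 p2 \<and>
        consecutive_vertices u v T p1 p2 p3 \<and> y \<bullet> p2 - y \<bullet> p3 \<ge> \<gamma>)"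

definition esqrt :: "ennreal \<Rightarrow> ennreal" where
  "esqrt x = (if x = \<infinity> then \<infinity> else ennreal (sqrt (enn2real x)))"

end

theory Submission
  imports Defs
begin

text \<open>
  Almost surely the points are generic, and then every edge of the polygon \<open>T = conv(a\<^sub>1,...,a\<^sub>n) \<inter> W\<close>
  is \<open>F\<^sub>I \<inter> W\<close> for some \<open>I\<close> with \<open>E\<^sub>I\<close>, so the expected number of edges is at most the sum of the
  \<open>P(E\<^sub>I)\<close>. The improbable \<open>I\<close> contribute at most 10; for the others \<open>P(E\<^sub>I)\<close> is at most ten times the
  probability that moreover the gap is at least \<open>\<gamma>\<close>. It remains to bound the number of edges of a polygon
  in a disc of radius \<open>R\<close> that have gap at least \<open>\<gamma>\<close>. If \<open>t\<^sub>1, t\<^sub>2\<close> are the unit tangents of \<open>[p\<^sub>1,p\<^sub>2]\<close>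
  and \<open>[p\<^sub>2,p\<^sub>3]\<close>, the gap is at most \<open>|t\<^sub>2 - t\<^sub>1| |p\<^sub>3 - p\<^sub>2|\<close>. The segments \<open>[p\<^sub>2,p\<^sub>3]\<close> are edges of \<open>T\<close>,
  of total length at most \<open>8R\<close>; the segments \<open>[t\<^sub>1,t\<^sub>2]\<close> are edges of a polygon inscribed in the unit
  circle, of total length at most \<open>8\<close>. By AM-GM there are at most \<open>8 sqrt(R / \<gamma>)\<close> such edges.
\<close>

section \<open>Edges of convex polygons in the plane\<close>

definition cross2 :: "real \<times> real \<Rightarrow> real \<times> real \<Rightarrow> real" where
  "cross2 a b = fst a * snd b - snd a * fst b"

text \<open>An edge of the convex hull of \<open>V\<close>, directed so that \<open>V\<close> lies
  on its left. It refers to the points of \<open>V\<close> alone, so it serves for vertex sets and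
  for sets of unit tangents alike.\<close>

definition support_edge :: "(real \<times> real) set \<Rightarrow> real \<times> real \<Rightarrow> real \<times> real \<Rightarrow> bool" where
  "support_edge V p q \<longleftrightarrow> p \<in> V \<and> q \<in> V \<and> p \<noteq> q \<and> (\<forall>x\<in>V. cross2 (q - p) (x - p) \<ge> 0)"

definition no_three_collinear :: "(real \<times> real) set \<Rightarrow> bool" where
  "no_three_collinear V \<longleftrightarrow>
     (\<forall>p\<in>V. \<forall>q\<in>V. \<forall>r\<in>V. p \<noteq> q \<longrightarrow> q \<noteq> r \<longrightarrow> p \<noteq> r \<longrightarrow> cross2 (q - p) (r - p) \<noteq> 0)"

lemma abs_cross2_le: "\<bar>cross2 a b\<bar> \<le> norm a * norm b"
proof -
  have "(cross2 a b)\<^sup>2 + (a \<bullet> b)\<^sup>2 = (norm a * norm b)\<^sup>2"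
    unfolding power_mult_distrib power2_norm_eq_inner cross2_def
    by (cases a; cases b) (simp add: power2_eq_square algebra_simps)
  then have "(cross2 a b)\<^sup>2 \<le> (norm a * norm b)\<^sup>2"
    by (smt (verit) zero_le_power2)
  then show ?thesis
    by (metis abs_le_square_iff abs_mult abs_norm_cancel)
qed

text \<open>Both edges run to the right with \<open>V\<close> above their lines, so over the
  abscissa \<open>s\<close> each passes on or above the other. They meet there, which forces both
  ends of one onto the line of the other, and that line carries only two points of
  \<open>V\<close>.\<close>

lemma support_edge_interval_disjoint:
  assumes V: "no_three_collinear V"
    and e: "support_edge V p q" and e': "support_edge V p' q'"
    and s: "fst p < s" "s < fst q" "fst p' < s" "s < fst q'"
  shows "p' = p \<and> q' = q"
proof -
  \<comment> \<open>\<open>f\<close> is the vertical height above the line through \<open>p\<close>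
    and \<open>q\<close>, and \<open>f'\<close> that above the line through \<open>p'\<close> and
    \<open>q'\<close>.\<close>
  define f where "f x = snd x - snd p - (snd q - snd p) / (fst q - fst p) * (fst x - fst p)" for x
  define f' where "f' x = snd x - snd p' - (snd q' - snd p') / (fst q' - fst p') * (fst x - fst p')" for x
  have crossf: "cross2 (q - p) (x - p) = (fst q - fst p) * f x" for x
    using s by (simp add: cross2_def f_def field_simps)
  have crossf': "cross2 (q' - p') (x - p') = (fst q' - fst p') * f' x" for x
    using s by (simp add: cross2_def f'_def field_simps)
  have f0: "f x \<ge> 0" if "x \<in> V" for x
  proof -
    have "(fst q - fst p) * f x \<ge> 0"
      using e that unfolding crossf[symmetric] support_edge_def by blast
    with s show ?thesis by (simp add: zero_le_mult_iff)
  qed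
  have f0': "f' x \<ge> 0" if "x \<in> V" for x
  proof -
    have "(fst q' - fst p') * f' x \<ge> 0"
      using e' that unfolding crossf'[symmetric] support_edge_def by blast
    with s show ?thesis by (simp add: zero_le_mult_iff)
  qed
  define a where "a = (s - fst p) / (fst q - fst p)"
  define a' where "a' = (s - fst p') / (fst q' - fst p')"
  have a: "0 < a" "a < 1" "s = fst p + a * (fst q - fst p)"
    using s by (auto simp: a_def field_simps)
  have a': "0 < a'" "a' < 1" "s = fst p' + a' * (fst q' - fst p')"
    using s by (auto simp: a'_def field_simps)
  define y where "y = snd p + a * (snd q - snd p)"
  define y' where "y' = snd p' + a' * (snd q' - snd p')"
  have nz: "fst q - fst p \<noteq> 0" "fst q' - fst p' \<noteq> 0" using s by auto
  have A: "f (s, y') = (1 - a') * f p' + a' * f q'"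
    unfolding f_def y'_def by (subst a'(3)) (simp add: algebra_simps add_divide_distrib diff_divide_distrib)
  have B: "f' (s, y) = (1 - a) * f' p + a * f' q"
    unfolding f'_def y_def by (subst a(3)) (simp add: algebra_simps add_divide_distrib diff_divide_distrib)
  have C: "f (s, y') = y' - y"
    using nz by (simp add: f_def y_def a(3))
  have D: "f' (s, y) = y - y'"
    using nz by (simp add: f'_def y'_def a'(3))
  have inV: "p \<in> V" "q \<in> V" "p' \<in> V" "q' \<in> V" and ne: "p \<noteq> q" "p' \<noteq> q'"
    using e e' by (auto simp: support_edge_def)
  have "f (s, y') \<ge> 0" "f' (s, y) \<ge> 0"
    unfolding A B using a a' f0 f0' inV by (auto intro!: add_nonneg_nonneg mult_nonneg_nonneg)
  then have z: "(1 - a') * f p' + a' * f q' = 0"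
    using C D A by linarith
  have "(1 - a') * f p' \<ge> 0" "a' * f q' \<ge> 0"
    using a' f0 inV by auto
  with z have "(1 - a') * f p' = 0" "a' * f q' = 0" by linarith+
  with a' have "f p' = 0" "f q' = 0" by auto
  then have "cross2 (q - p) (p' - p) = 0" "cross2 (q - p) (q' - p) = 0"
    by (simp_all add: crossf)
  then have "p' = p \<or> p' = q" "q' = p \<or> q' = q"
    using V inV ne unfolding no_three_collinear_def by metis+
  \<comment> \<open>The abscissas leave one matching only: \<open>p\<close> and \<open>p'\<close>
    lie to the left of \<open>s\<close>, \<open>q\<close> and \<open>q'\<close> to its
    right.\<close>
  then show ?thesis using s ne by auto
qed

text \<open>The rightward edges project to pairwise disjoint open intervals inside
  \<open>{-R..R}\<close>, which has length \<open>2 * R\<close>; all other edges contribute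
  0.\<close>

lemma sum_positive_runs_le:
  fixes P Q :: "'i \<Rightarrow> real \<times> real"
  assumes V: "no_three_collinear V" and A: "finite A"
    and e: "\<And>i. i \<in> A \<Longrightarrow> support_edge V (P i) (Q i)"
    and inj: "inj_on (\<lambda>i. (P i, Q i)) A"
    and R: "\<And>x. x \<in> V \<Longrightarrow> \<bar>fst x\<bar> \<le> R" and R0: "0 \<le> R"
  shows "(\<Sum>i\<in>A. max 0 (fst (Q i) - fst (P i))) \<le> 2 * R"
proof -
  define B where "B = {i \<in> A. fst (P i) < fst (Q i)}"
  define S where "S i = {fst (P i)<..<fst (Q i)}" for i
  have finB: "finite B" using A by (simp add: B_def)
  have disj: "disjoint_family_on S B"
    unfolding disjoint_family_on_def
  proof (intro ballI impI)
    fix i j assume ij: "i \<in> B" "j \<in> B" "i \<noteq> j"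
    show "S i \<inter> S j = {}"
    proof (rule ccontr)
      assume "S i \<inter> S j \<noteq> {}"
      then obtain s where "s \<in> S i" "s \<in> S j" by blast
      then have "P j = P i \<and> Q j = Q i"
        using ij e by (intro support_edge_interval_disjoint[OF V, of _ _ _ _ s]) (auto simp: S_def B_def)
      with ij inj show False by (auto simp: inj_on_def B_def)
    qed
  qed
  have "(\<Sum>i\<in>A. max 0 (fst (Q i) - fst (P i))) = (\<Sum>i\<in>B. measure lborel (S i))"
    using A by (intro sum.mono_neutral_cong_right) (auto simp: B_def S_def)
  also have "\<dots> = measure lborel (\<Union>i\<in>B. S i)"
    using finB by (intro measure_finite_Union[symmetric] disj) (auto simp: S_def B_def)
  also have "\<dots> \<le> measure lborel {-R..R}"
  proof (rule measure_mono_fmeasurable)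
    show "(\<Union>i\<in>B. S i) \<subseteq> {- R..R}"
    proof
      fix s assume "s \<in> (\<Union>i\<in>B. S i)"
      then obtain i where i: "i \<in> B" "s \<in> S i" by blast
      then have "P i \<in> V" "Q i \<in> V" using e by (auto simp: B_def support_edge_def)
      with R[of "P i"] R[of "Q i"] i show "s \<in> {-R..R}" by (auto simp: S_def)
    qed
  qed (use finB R0 in \<open>auto simp: S_def intro!: fmeasurableI\<close>)
  also have "\<dots> = 2 * R" using R0 by simp
  finally show ?thesis .
qed

definition rot90 :: "real \<times> real \<Rightarrow> real \<times> real" where
  "rot90 x = (- snd x, fst x)"

lemma rot90_eq_iff [simp]: "rot90 x = rot90 y \<longleftrightarrow> x = y"
  by (auto simp: rot90_def prod_eq_iff)

lemma cross2_rot90 [simp]: "cross2 (rot90 a - rot90 b) (rot90 c - rot90 d) = cross2 (a - b) (c - d)"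
  by (simp add: cross2_def rot90_def algebra_simps)

lemma norm_rot90 [simp]: "norm (rot90 x) = norm x"
  by (cases x) (simp add: rot90_def norm_Pair add.commute)

lemma support_edge_rot90: "support_edge V p q \<Longrightarrow> support_edge (rot90 ` V) (rot90 p) (rot90 q)"
  by (auto simp: support_edge_def)

lemma no_three_collinear_rot90: "no_three_collinear V \<Longrightarrow> no_three_collinear (rot90 ` V)"
  by (auto simp: no_three_collinear_def)

lemma abs_fst_le_norm: "\<bar>fst (x::real \<times> real)\<bar> \<le> norm x"
  by (metis norm_fst_le real_norm_def prod.collapse)

text \<open>A length is at most the sum of the positive parts of the vector in the four axis
  directions. Quarter turns bring each of these directions to the rightward one, and each costs at
  most \<open>2 * R\<close>.\<close>

lemma sum_edge_lengths_le:
  fixes P Q :: "'i \<Rightarrow> real \<times> real"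
  assumes V: "no_three_collinear V" and A: "finite A"
    and e: "\<And>i. i \<in> A \<Longrightarrow> support_edge V (P i) (Q i)"
    and inj: "inj_on (\<lambda>i. (P i, Q i)) A"
    and R: "\<And>x. x \<in> V \<Longrightarrow> norm x \<le> R" and R0: "0 \<le> R"
  shows "(\<Sum>i\<in>A. norm (Q i - P i)) \<le> 8 * R"
proof -
  let ?r = "\<lambda>k. rot90 ^^ k"
  let ?s = "\<lambda>k. \<Sum>i\<in>A. max 0 (fst (?r k (Q i)) - fst (?r k (P i)))"
  have rot: "?s k \<le> 2 * R" for k :: nat
  proof (rule sum_positive_runs_le[OF _ A _ _ _ R0, where V = "?r k ` V"])
    show "no_three_collinear (?r k ` V)"
      by (induction k) (use V no_three_collinear_rot90 in \<open>auto simp flip: image_image\<close>)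
    show "support_edge (?r k ` V) (?r k (P i)) (?r k (Q i))" if "i \<in> A" for i
      by (induction k) (use e[OF that] support_edge_rot90 in \<open>auto simp flip: image_image\<close>)
    have "?r k x = ?r k y \<longleftrightarrow> x = y" for x y by (induction k) auto
    then show "inj_on (\<lambda>i. (?r k (P i), ?r k (Q i))) A"
      using inj by (simp add: inj_on_def)
    have n: "norm (?r k x) = norm x" for x by (induction k) auto
    show "\<bar>fst x\<bar> \<le> R" if "x \<in> ?r k ` V" for x
      using that R abs_fst_le_norm[of x] n by fastforce
  qed
  have "norm (Q i - P i) \<le> max 0 (fst (?r 0 (Q i)) - fst (?r 0 (P i))) + max 0 (fst (?r 1 (Q i)) - fst (?r 1 (P i)))
      + max 0 (fst (?r 2 (Q i)) - fst (?r 2 (P i))) + max 0 (fst (?r 3 (Q i)) - fst (?r 3 (P i)))" for i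
  proof -
    have "norm (Q i - P i) \<le> \<bar>fst (Q i) - fst (P i)\<bar> + \<bar>snd (Q i) - snd (P i)\<bar>"
      using norm_Pair_le[of "fst (Q i) - fst (P i)" "snd (Q i) - snd (P i)"]
      by (simp add: minus_prod_def)
    also have "\<dots> = max 0 (fst (?r 0 (Q i)) - fst (?r 0 (P i))) + max 0 (fst (?r 1 (Q i)) - fst (?r 1 (P i)))
      + max 0 (fst (?r 2 (Q i)) - fst (?r 2 (P i))) + max 0 (fst (?r 3 (Q i)) - fst (?r 3 (P i)))"
      \<comment> \<open>After 0, 1, 2 and 3 quarter turns the first coordinate is
        \<open>fst\<close>, minus \<open>snd\<close>, minus \<open>fst\<close> and
        \<open>snd\<close>.\<close>
      by (simp add: rot90_def numeral_2_eq_2 numeral_3_eq_3)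
    finally show ?thesis .
  qed
  then have "(\<Sum>i\<in>A. norm (Q i - P i)) \<le> ?s 0 + ?s 1 + ?s 2 + ?s 3"
    unfolding sum.distrib[symmetric] by (intro sum_mono)
  with rot[of 0] rot[of 1] rot[of 2] rot[of 3] show ?thesis by linarith
qed

section \<open>Edges determined by their direction or their end point\<close>

lemma cross2_scaleR [simp]:
  "cross2 (c *\<^sub>R a) b = c * cross2 a b" "cross2 a (c *\<^sub>R b) = c * cross2 a b"
  by (simp_all add: cross2_def algebra_simps)

lemma cross2_self [simp]: "cross2 a a = 0"
  by (simp add: cross2_def)

lemma sgn_eq_imp_scaleR:
  fixes a b :: "'a::real_normed_vector"
  assumes "sgn a = sgn b" "b \<noteq> 0"
  shows "\<exists>c>0. a = c *\<^sub>R b"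
proof -
  have a0: "a \<noteq> 0" using assms by (metis sgn_zero_iff)
  have "a = norm a *\<^sub>R sgn a" using a0 by (simp add: sgn_div_norm)
  also have "\<dots> = (norm a / norm b) *\<^sub>R b" using assms by (simp add: sgn_div_norm divide_inverse)
  finally show ?thesis using a0 assms by (intro exI[of _ "norm a / norm b"]) auto
qed

text \<open>Each of the two parallel lines has the other edge on its left, so the lines coincide,
  and a line carries at most two points of \<open>V\<close>. The common direction excludes the
  reversed edge.\<close>

lemma support_edge_direction_unique:
  assumes V: "no_three_collinear V"
    and e: "support_edge V p q" and e': "support_edge V p' q'"
    and dir: "sgn (q - p) = sgn (q' - p')"
  shows "p = p' \<and> q = q'"
proof -
  have inV: "p \<in> V" "q \<in> V" "p' \<in> V" "q' \<in> V" and ne: "p \<noteq> q" "p' \<noteq> q'"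
    using e e' by (auto simp: support_edge_def)
  obtain c where c: "c > 0" "q - p = c *\<^sub>R (q' - p')"
    using sgn_eq_imp_scaleR[OF dir] ne by auto
  have 1: "cross2 (q - p) (x - p) \<ge> 0" if "x \<in> V" for x
    using e that by (auto simp: support_edge_def)
  have 2: "cross2 (q - p) (x - p') \<ge> 0" if "x \<in> V" for x
    using e' that c by (auto simp: support_edge_def)
  have "cross2 (q - p) (p' - p) = - cross2 (q - p) (p - p')"
    by (simp add: cross2_def algebra_simps)
  with 1[of p'] 2[of p] inV have z: "cross2 (q - p) (p' - p) = 0" by linarith
  have "cross2 (q - p) (q' - p) = cross2 (q - p) (p' - p) + cross2 (q - p) (q' - p')"
    by (simp add: cross2_def algebra_simps)
  also have "cross2 (q - p) (q' - p') = 0" using c by simp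
  finally have z': "cross2 (q - p) (q' - p) = 0" using z by simp
  have *: "p' = p \<or> p' = q" "q' = p \<or> q' = q"
    using z z' V inV ne unfolding no_three_collinear_def by metis+
  show ?thesis
  proof (rule ccontr)
    assume "\<not> (p = p' \<and> q = q')"
    with * ne have "p' = q" "q' = p" by auto
    with c have "(1 + c) *\<^sub>R (q - p) = 0" by (simp add: algebra_simps)
    with c ne show False by auto
  qed
qed

text \<open>Two different predecessors would give the triangle \<open>p\<close>, \<open>q\<close>,
  \<open>p'\<close> both orientations, so it would be degenerate.\<close>

lemma support_edge_predecessor_unique:
  assumes V: "no_three_collinear V"
    and e: "support_edge V p q" and e': "support_edge V p' q"
  shows "p = p'"
proof (rule ccontr)
  assume ne: "p \<noteq> p'"
  have "cross2 (q - p) (p' - p) \<ge> 0" "cross2 (q - p') (p - p') \<ge> 0"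
    using e e' by (auto simp: support_edge_def)
  moreover have "cross2 (q - p') (p - p') = - cross2 (q - p) (p' - p)"
    by (simp add: cross2_def algebra_simps)
  ultimately have "cross2 (q - p) (p' - p) = 0" by linarith
  then show False using V e e' ne unfolding no_three_collinear_def support_edge_def by metis
qed

section \<open>The polygon of unit edge directions\<close>

definition tangents :: "(real \<times> real) set \<Rightarrow> (real \<times> real) set" where
  "tangents V = {sgn (q - p) | p q. support_edge V p q}"

lemma norm_tangent: "t \<in> tangents V \<Longrightarrow> norm t = 1"
proof -
  assume "t \<in> tangents V"
  then obtain p q where "t = sgn (q - p)" "p \<noteq> q"
    unfolding tangents_def support_edge_def by blast
  then show ?thesis by (simp add: norm_sgn)
qed

lemma circle_no_three_collinear:
  assumes "\<And>t. t \<in> V \<Longrightarrow> norm t = 1"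
  shows "no_three_collinear V"
  unfolding no_three_collinear_def
proof (intro ballI impI notI)
  fix p q r assume inV: "p \<in> V" "q \<in> V" "r \<in> V" and ne: "p \<noteq> q" "q \<noteq> r" "p \<noteq> r"
    and z: "cross2 (q - p) (r - p) = 0"
  obtain p1 p2 q1 q2 r1 r2 where [simp]: "p = (p1, p2)" "q = (q1, q2)" "r = (r1, r2)"
    by (metis prod.exhaust)
  have n: "p1\<^sup>2 + p2\<^sup>2 = 1" "q1\<^sup>2 + q2\<^sup>2 = 1" "r1\<^sup>2 + r2\<^sup>2 = 1"
    using assms[OF inV(1)] assms[OF inV(2)] assms[OF inV(3)] by (simp_all add: norm_Pair)
  have cr: "(q1 - p1) * (r2 - p2) = (q2 - p2) * (r1 - p1)"
    using z by (simp add: cross2_def)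
  \<comment> \<open>For a triangle inscribed in the unit circle the product of the squared sides is
    four times the squared cross product, which is 0 here.\<close>
  have key: "((q1 - p1)\<^sup>2 + (q2 - p2)\<^sup>2) * ((r1 - p1)\<^sup>2 + (r2 - p2)\<^sup>2) * ((r1 - q1)\<^sup>2 + (r2 - q2)\<^sup>2) = 0"
    using n cr by algebra
  have "(q1 - p1)\<^sup>2 + (q2 - p2)\<^sup>2 \<noteq> 0" "(r1 - p1)\<^sup>2 + (r2 - p2)\<^sup>2 \<noteq> 0" "(r1 - q1)\<^sup>2 + (r2 - q2)\<^sup>2 \<noteq> 0"
    using ne by (auto simp: sum_power2_eq_zero_iff)
  with key show False by (metis mult_eq_0_iff)
qed

lemma cross2_consecutive_pos:
  assumes V: "no_three_collinear V"
    and e: "support_edge V p1 p2" and e': "support_edge V p2 p3" and "p1 \<noteq> p3"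
  shows "cross2 (p2 - p1) (p3 - p2) > 0"
proof -
  have "cross2 (p2 - p1) (p3 - p2) = cross2 (p2 - p1) (p3 - p1)"
    by (simp add: cross2_def algebra_simps)
  moreover have "cross2 (p2 - p1) (p3 - p1) \<ge> 0" "cross2 (p2 - p1) (p3 - p1) \<noteq> 0"
    using assms unfolding no_three_collinear_def support_edge_def by metis+
  ultimately show ?thesis by linarith
qed

text \<open>No tangent direction lies strictly between those of two consecutive edges, since the
  corresponding supporting line would touch the polygon only at their common vertex.\<close>

lemma support_edge_tangents:
  assumes V: "no_three_collinear V"
    and e: "support_edge V p1 p2" and e': "support_edge V p2 p3" and ne: "p1 \<noteq> p3"
  shows "support_edge (tangents V) (sgn (p2 - p1)) (sgn (p3 - p2))"
proof -
  define t1 where "t1 = sgn (p2 - p1)"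
  define t2 where "t2 = sgn (p3 - p2)"
  have d: "p1 \<noteq> p2" "p2 \<noteq> p3" using e e' by (auto simp: support_edge_def)
  have c: "cross2 t1 t2 > 0"
    using cross2_consecutive_pos[OF assms] d by (simp add: t1_def t2_def sgn_div_norm)
  have n: "norm t1 = 1" "norm t2 = 1" using d by (simp_all add: t1_def t2_def norm_sgn)
  have in1: "cross2 t1 (x - p2) \<ge> 0" if "x \<in> V" for x
  proof -
    have "cross2 (p2 - p1) (x - p2) = cross2 (p2 - p1) (x - p1)"
      by (simp add: cross2_def algebra_simps)
    also have "\<dots> \<ge> 0" using e that by (auto simp: support_edge_def)
    finally show ?thesis by (simp add: t1_def sgn_div_norm)
  qed
  have in2: "cross2 t2 (x - p2) \<ge> 0" if "x \<in> V" for x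
    using e' that by (simp add: t2_def sgn_div_norm support_edge_def)
  have main: "cross2 (t2 - t1) (t - t1) \<ge> 0" if t: "t \<in> tangents V" for t
  proof (rule ccontr)
    assume neg: "\<not> cross2 (t2 - t1) (t - t1) \<ge> 0"
    obtain p q where pq: "support_edge V p q" "t = sgn (q - p)"
      using t unfolding tangents_def by blast
    \<comment> \<open>The coordinates of \<open>t\<close> in the basis \<open>t1\<close>,
      \<open>t2\<close>, by Cramer's rule. A violation of the claim means that their sum exceeds
      1.\<close>
    define \<alpha> where "\<alpha> = cross2 t t2 / cross2 t1 t2"
    define \<beta> where "\<beta> = cross2 t1 t / cross2 t1 t2"
    have comb: "t = \<alpha> *\<^sub>R t1 + \<beta> *\<^sub>R t2"
    proof -
      have "cross2 t1 t2 * fst t = cross2 t t2 * fst t1 + cross2 t1 t * fst t2"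
           "cross2 t1 t2 * snd t = cross2 t t2 * snd t1 + cross2 t1 t * snd t2"
        by (simp_all add: cross2_def algebra_simps)
      then show ?thesis using c by (simp add: prod_eq_iff \<alpha>_def \<beta>_def field_simps)
    qed
    have "cross2 (t2 - t1) (t - t1) = cross2 t1 t2 * (1 - \<alpha> - \<beta>)"
      by (subst comb) (simp add: cross2_def algebra_simps)
    with neg c have sum1: "\<alpha> + \<beta> > 1"
      by (simp add: not_le mult_less_0_iff)
    have nt: "norm t = 1" using t by (rule norm_tangent)
    \<comment> \<open>If one coordinate were not positive, the other would exceed its absolute value
      by more than 1, and \<open>t\<close> would be longer than 1.\<close>
    have "norm (\<alpha> *\<^sub>R t1 + \<beta> *\<^sub>R t2) \<ge> \<bar>\<bar>\<alpha>\<bar> - \<bar>\<beta>\<bar>\<bar>"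
      using norm_triangle_ineq3[of "\<alpha> *\<^sub>R t1" "- (\<beta> *\<^sub>R t2)"] n by simp
    then have "\<bar>\<bar>\<alpha>\<bar> - \<bar>\<beta>\<bar>\<bar> \<le> 1" using comb nt by simp
    with sum1 have pos: "\<alpha> > 0" "\<beta> > 0" by linarith+
    \<comment> \<open>With both coefficients positive, \<open>cross2 t\<close> attains its minimum
      over \<open>V\<close> at \<open>p2\<close> alone; but it is minimal at both ends of the edge
      from \<open>p\<close> to \<open>q\<close>.\<close>
    have at: "x = p2" if x: "x \<in> V" "cross2 t (x - p) = 0" for x
    proof -
      have ct: "cross2 t (z - p2) = \<alpha> * cross2 t1 (z - p2) + \<beta> * cross2 t2 (z - p2)" for z
        by (subst comb) (simp add: cross2_def algebra_simps)
      have "cross2 t (p2 - p) \<ge> 0"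
        using pq e by (auto simp: support_edge_def sgn_div_norm)
      moreover have "cross2 t (x - p2) = cross2 t (x - p) - cross2 t (p2 - p)"
        by (simp add: cross2_def algebra_simps)
      ultimately have "\<alpha> * cross2 t1 (x - p2) + \<beta> * cross2 t2 (x - p2) \<le> 0"
        using x ct[of x] by linarith
      moreover have "\<alpha> * cross2 t1 (x - p2) \<ge> 0" "\<beta> * cross2 t2 (x - p2) \<ge> 0"
        using pos in1 in2 x by auto
      ultimately have "\<alpha> * cross2 t1 (x - p2) = 0" "\<beta> * cross2 t2 (x - p2) = 0"
        by linarith+
      then have z: "cross2 t1 (x - p2) = 0" "cross2 t2 (x - p2) = 0" using pos by auto
      have "cross2 t1 t2 * fst (x - p2) = cross2 t1 (x - p2) * fst t2 - cross2 t2 (x - p2) * fst t1"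
           "cross2 t1 t2 * snd (x - p2) = cross2 t1 (x - p2) * snd t2 - cross2 t2 (x - p2) * snd t1"
        by (simp_all add: cross2_def algebra_simps)
      with z c have "fst (x - p2) = 0" "snd (x - p2) = 0" by auto
      then show ?thesis by (simp add: prod_eq_iff)
    qed
    have "p = p2"
      using pq by (intro at) (auto simp: support_edge_def cross2_def)
    moreover have "q = p2"
      using pq by (intro at) (auto simp: support_edge_def sgn_div_norm)
    ultimately show False using pq by (auto simp: support_edge_def)
  qed
  have "t1 \<noteq> t2" using c by auto
  moreover have "t1 \<in> tangents V" "t2 \<in> tangents V"
    using e e' unfolding tangents_def t1_def t2_def by blast+
  ultimately show ?thesis using main by (simp add: support_edge_def t1_def t2_def)
qed

text \<open>The weighted AM-GM estimate for one triple is summed over \<open>G\<close>. The tangent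
  polygon has total edge length at most 8, which yields the first term, and \<open>V\<close> at most
  \<open>8 * R\<close>, which yields the second.\<close>

lemma card_gap_triples_le:
  assumes V: "no_three_collinear V" and G: "finite G"
    and R: "\<And>x. x \<in> V \<Longrightarrow> norm x \<le> R" and R0: "0 \<le> R"
    and \<gamma>: "0 < \<gamma>" and \<mu>: "0 < \<mu>"
    and gap: "\<And>p1 p2 p3. (p1, p2, p3) \<in> G \<Longrightarrow> support_edge V p1 p2 \<and> support_edge V p2 p3 \<and>
        p1 \<noteq> p3 \<and> \<gamma> \<le> cross2 (sgn (p2 - p1)) (p3 - p2)"
  shows "real (card G) \<le> 4 * \<mu> + 4 * R / (\<gamma> * \<mu>)"
proof -
  define t1 where "t1 = (\<lambda>(p1::real\<times>real, p2::real\<times>real, p3::real\<times>real). sgn (p2 - p1))"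
  define t2 where "t2 = (\<lambda>(p1::real\<times>real, p2::real\<times>real, p3::real\<times>real). sgn (p3 - p2))"
  define s1 where "s1 = (\<lambda>(p1::real\<times>real, p2::real\<times>real, p3::real\<times>real). p2)"
  define s2 where "s2 = (\<lambda>(p1::real\<times>real, p2::real\<times>real, p3::real\<times>real). p3)"
  have S: "(\<Sum>g\<in>G. norm (s2 g - s1 g)) \<le> 8 * R"
  proof (rule sum_edge_lengths_le[OF V G _ _ R R0])
    show "support_edge V (s1 g) (s2 g)" if "g \<in> G" for g
      using that gap by (cases g) (auto simp: s1_def s2_def)
    \<comment> \<open>The edge from \<open>p2\<close> to \<open>p3\<close> fixes the triple, because
      \<open>p2\<close> has only one predecessor.\<close>
    show "inj_on (\<lambda>i. (s1 i, s2 i)) G"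
      unfolding inj_on_def
    proof (intro ballI impI)
      fix g h assume g: "g \<in> G" "h \<in> G" "(s1 g, s2 g) = (s1 h, s2 h)"
      obtain p1 p2 p3 where [simp]: "g = (p1, p2, p3)" by (metis prod.exhaust)
      obtain q1 q2 q3 where [simp]: "h = (q1, q2, q3)" by (metis prod.exhaust)
      show "g = h"
        using support_edge_predecessor_unique[OF V, of p1 p2 q1] g gap[of p1 p2 p3] gap[of q1 q2 q3]
        by (simp add: s1_def s2_def)
    qed
  qed
  have T: "(\<Sum>g\<in>G. norm (t2 g - t1 g)) \<le> 8 * 1"
  proof (rule sum_edge_lengths_le[where V = "tangents V"])
    show "no_three_collinear (tangents V)"
      by (intro circle_no_three_collinear norm_tangent)
    show "support_edge (tangents V) (t1 g) (t2 g)" if "g \<in> G" for g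
      using that gap support_edge_tangents[OF V] by (cases g) (auto simp: t1_def t2_def)
    \<comment> \<open>The two directions fix the two edges, hence the triple.\<close>
    show "inj_on (\<lambda>i. (t1 i, t2 i)) G"
      unfolding inj_on_def
    proof (intro ballI impI)
      fix g h assume g: "g \<in> G" "h \<in> G" "(t1 g, t2 g) = (t1 h, t2 h)"
      obtain p1 p2 p3 where [simp]: "g = (p1, p2, p3)" by (metis prod.exhaust)
      obtain q1 q2 q3 where [simp]: "h = (q1, q2, q3)" by (metis prod.exhaust)
      show "g = h"
        using support_edge_direction_unique[OF V, of p1 p2 q1 q2]
          support_edge_direction_unique[OF V, of p2 p3 q2 q3] g gap[of p1 p2 p3] gap[of q1 q2 q3]
        by (simp add: t1_def t2_def)
    qed
  qed (use G norm_tangent in auto)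
  have each: "1 \<le> \<mu> / 2 * norm (t2 g - t1 g) + 1 / (2 * \<mu> * \<gamma>) * norm (s2 g - s1 g)" if g: "g \<in> G" for g
  proof -
    obtain p1 p2 p3 where [simp]: "g = (p1, p2, p3)" by (metis prod.exhaust)
    define a where "a = norm (t2 g - t1 g)"
    define b where "b = norm (s2 g - s1 g)"
    have ab: "a \<ge> 0" "b \<ge> 0" by (simp_all add: a_def b_def)
    have "\<gamma> \<le> cross2 (t1 g) (s2 g - s1 g)"
      using gap g by (auto simp: t1_def s1_def s2_def)
    \<comment> \<open>The second edge is parallel to \<open>t2\<close>, so only the change of
      direction contributes.\<close>
    also have "\<dots> = cross2 (t1 g - t2 g) (s2 g - s1 g) + cross2 (t2 g) (s2 g - s1 g)"
      by (simp add: cross2_def algebra_simps)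
    also have "cross2 (t2 g) (s2 g - s1 g) = 0"
      by (simp add: t2_def s1_def s2_def sgn_div_norm)
    also have "cross2 (t1 g - t2 g) (s2 g - s1 g) + 0 \<le> a * b"
      using abs_cross2_le[of "t1 g - t2 g" "s2 g - s1 g"] by (simp add: a_def b_def norm_minus_commute)
    finally have ga: "\<gamma> \<le> a * b" .
    \<comment> \<open>AM-GM, with the weight \<open>\<mu>\<close> left free\<close>
    have "4 * \<gamma> * (\<mu>\<^sup>2 * \<gamma>) \<le> 4 * (a * b) * (\<mu>\<^sup>2 * \<gamma>)"
      using ga \<gamma> \<mu> by simp
    also have "\<dots> \<le> (\<mu>\<^sup>2 * \<gamma> * a + b)\<^sup>2"
      using zero_le_power2[of "\<mu>\<^sup>2 * \<gamma> * a - b"] by (simp add: power2_eq_square algebra_simps)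
    finally have "(2 * \<mu> * \<gamma>)\<^sup>2 \<le> (\<mu>\<^sup>2 * \<gamma> * a + b)\<^sup>2"
      by (simp add: power2_eq_square algebra_simps)
    then have "2 * \<mu> * \<gamma> \<le> \<mu>\<^sup>2 * \<gamma> * a + b"
      by (rule power2_le_imp_le) (use \<gamma> \<mu> ab in auto)
    then show ?thesis
      unfolding a_def[symmetric] b_def[symmetric]
      using \<gamma> \<mu> by (simp add: field_simps power2_eq_square)
  qed
  have "real (card G) = (\<Sum>g\<in>G. 1)" by simp
  also have "\<dots> \<le> (\<Sum>g\<in>G. \<mu> / 2 * norm (t2 g - t1 g) + 1 / (2 * \<mu> * \<gamma>) * norm (s2 g - s1 g))"
    by (intro sum_mono each)
  also have "\<dots> = \<mu> / 2 * (\<Sum>g\<in>G. norm (t2 g - t1 g)) + 1 / (2 * \<mu> * \<gamma>) * (\<Sum>g\<in>G. norm (s2 g - s1 g))"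
    by (simp add: sum.distrib sum_distrib_left)
  also have "\<dots> \<le> \<mu> / 2 * (8 * 1) + 1 / (2 * \<mu> * \<gamma>) * (8 * R)"
    using S T \<mu> \<gamma> by (intro add_mono mult_left_mono) auto
  also have "\<dots> = 4 * \<mu> + 4 * R / (\<gamma> * \<mu>)"
    by (simp add: field_simps)
  finally show ?thesis .
qed

section \<open>Oriented planes\<close>

text \<open>As the turn from \<open>u\<close> to \<open>v\<close> counts as clockwise, clockwise
  turns in the plane become turns with positive \<open>cross2\<close> in these coordinates. The
  polygon then lies to the left of its edges, as \<open>support_edge\<close> demands.\<close>

definition plane_coords :: "'a::euclidean_space \<Rightarrow> 'a \<Rightarrow> 'a \<Rightarrow> real \<times> real" where
  "plane_coords u v x = (x \<bullet> u, x \<bullet> v)"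

lemma clockwise_turn_cross2:
  "clockwise_turn u v p q r \<longleftrightarrow>
     cross2 (plane_coords u v q - plane_coords u v p) (plane_coords u v r - plane_coords u v p) > 0"
  by (simp add: clockwise_turn_def cross2_def plane_coords_def inner_diff_left)

lemma cross2_cyclic: "cross2 (q - p) (r - p) = cross2 (r - q) (p - q)"
  by (simp add: cross2_def algebra_simps)

lemma cross2_antisym: "cross2 (q - p) (r - p) = - cross2 (r - p) (q - p)"
  by (simp add: cross2_def algebra_simps)

lemma oriented_plane_expand:
  fixes W :: "'a::euclidean_space set"
  assumes "oriented_plane W u v" "x \<in> W"
  shows "x = (x \<bullet> u) *\<^sub>R u + (x \<bullet> v) *\<^sub>R v"
proof -
  have o: "subspace W" "dim W = 2" "u \<in> W" "v \<in> W" "u \<bullet> u = 1" "v \<bullet> v = 1" "u \<bullet> v = 0" "v \<bullet> u = 0"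
    using assms(1) by (auto simp: oriented_plane_def orthogonal_def norm_eq_1 inner_commute)
  have ind: "independent {u, v}"
    using o by (intro pairwise_orthogonal_independent)
      (auto simp: pairwise_def orthogonal_def)
  have "u \<noteq> v" using o by auto
  then have "W \<subseteq> span {u, v}"
    using o ind by (intro card_ge_dim_independent) auto
  with assms(2) obtain a b where "x = a *\<^sub>R u + b *\<^sub>R v"
    by (auto simp: span_insert span_singleton algebra_simps)
  then show ?thesis using o by (simp add: inner_add_left)
qed

lemma oriented_plane_inner:
  fixes W :: "'a::euclidean_space set"
  assumes W: "oriented_plane W u v" and "x \<in> W" "y \<in> W"
  shows "x \<bullet> y = plane_coords u v x \<bullet> plane_coords u v y"
proof -
  have "x \<bullet> y = ((x \<bullet> u) *\<^sub>R u + (x \<bullet> v) *\<^sub>R v) \<bullet> y"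
    using oriented_plane_expand[OF W \<open>x \<in> W\<close>] by simp
  then show ?thesis
    by (simp add: plane_coords_def inner_add_left) (simp add: inner_commute)
qed

lemma oriented_plane_norm:
  fixes W :: "'a::euclidean_space set"
  assumes "oriented_plane W u v" "x \<in> W"
  shows "norm (plane_coords u v x) = norm x"
  using oriented_plane_inner[OF assms assms(2)] by (simp add: norm_eq_sqrt_inner)

lemma plane_coords_inj:
  fixes W :: "'a::euclidean_space set"
  assumes "oriented_plane W u v" "x \<in> W" "y \<in> W" "plane_coords u v x = plane_coords u v y"
  shows "x = y"
  using oriented_plane_expand[OF assms(1,2)] oriented_plane_expand[OF assms(1,3)] assms(4)
  by (simp add: plane_coords_def)

lemma clockwise_vertices_no_three_collinear:
  fixes T :: "'a::euclidean_space set"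
  assumes "clockwise_vertices u v T qs"
  shows "no_three_collinear (plane_coords u v ` set qs)"
proof -
  let ?q = "\<lambda>i. plane_coords u v (qs ! i)"
  have pos: "cross2 (?q j - ?q i) (?q l - ?q i) > 0" if "i < j" "j < l" "l < length qs" for i j l
    using assms that by (auto simp: clockwise_vertices_def clockwise_turn_cross2)
  have nz: "cross2 (?q j - ?q i) (?q l - ?q i) \<noteq> 0"
    if "i \<noteq> j" "j \<noteq> l" "i \<noteq> l" "i < length qs" "j < length qs" "l < length qs" for i j l
  proof -
    \<comment> \<open>The first three orders are rotations of an increasing triple and keep the sign
      of \<open>cross2\<close>; the last three are odd permutations and reverse it.\<close>
    consider "i < j" "j < l" | "j < l" "l < i" | "l < i" "i < j" | "i < l" "l < j" | "l < j" "j < i" | "j < i" "i < l"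
      using \<open>i \<noteq> j\<close> \<open>j \<noteq> l\<close> \<open>i \<noteq> l\<close> by (metis linorder_neqE_nat)
    then show ?thesis
    proof cases
      case 1 with pos[of i j l] that show ?thesis by simp
    next
      case 2 with pos[of j l i] that show ?thesis by (subst cross2_cyclic) simp
    next
      case 3 with pos[of l i j] that show ?thesis by (subst cross2_cyclic, subst cross2_cyclic) simp
    next
      case 4 with pos[of i l j] that show ?thesis by (subst cross2_antisym) simp
    next
      case 5 with pos[of l j i] that show ?thesis by (subst cross2_antisym, subst cross2_cyclic) simp
    next
      case 6 with pos[of j i l] that show ?thesis
        by (subst cross2_antisym, subst cross2_cyclic, subst cross2_cyclic) simp
    qed
  qed
  show ?thesis
    unfolding no_three_collinear_def
  proof (intro ballI impI)
    fix p q r assume "p \<in> plane_coords u v ` set qs" "q \<in> plane_coords u v ` set qs" "r \<in> plane_coords u v ` set qs"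
      and ne: "p \<noteq> q" "q \<noteq> r" "p \<noteq> r"
    then obtain i j l where "i < length qs" "j < length qs" "l < length qs" "p = ?q i" "q = ?q j" "r = ?q l"
      by (auto simp: in_set_conv_nth)
    with ne nz[of i j l] show "cross2 (q - p) (r - p) \<noteq> 0" by auto
  qed
qed

text \<open>No index lies cyclically between \<open>i\<close> and its successor, so together with
  any third index they form a rotation of an increasing triple.\<close>

lemma clockwise_vertices_support_edge:
  fixes T :: "'a::euclidean_space set"
  assumes "clockwise_vertices u v T qs" and i: "i < length qs"
    and ne: "plane_coords u v (qs ! i) \<noteq> plane_coords u v (qs ! ((i + 1) mod length qs))"
  shows "support_edge (plane_coords u v ` set qs) (plane_coords u v (qs ! i))
           (plane_coords u v (qs ! ((i + 1) mod length qs)))"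
proof -
  let ?q = "\<lambda>i. plane_coords u v (qs ! i)"
  have pos: "cross2 (?q j - ?q i) (?q l - ?q i) > 0" if "i < j" "j < l" "l < length qs" for i j l
    using assms that by (auto simp: clockwise_vertices_def clockwise_turn_cross2)
  have nn: "cross2 (?q ((i + 1) mod length qs) - ?q i) (?q l - ?q i) \<ge> 0" if l: "l < length qs" for l
  proof (cases "i + 1 < length qs")
    case True
    then have m: "(i + 1) mod length qs = i + 1" by simp
    consider "l < i" | "l = i" | "l = i + 1" | "i + 1 < l" by linarith
    then show ?thesis
    proof cases
      case 1
      with True pos[of l i "i + 1"] show ?thesis
        unfolding m using cross2_cyclic[of "?q i" "?q l" "?q (i + 1)"] by simp
    next
      case 4
      with l pos[of i "i + 1" l] show ?thesis unfolding m by simp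
    qed (unfold m, simp_all add: cross2_def)
  \<comment> \<open>Now \<open>i\<close> is the last index, and its successor wraps round to
    0.\<close>
  next
    case False
    with i have "i + 1 = length qs" by simp
    then have m: "(i + 1) mod length qs = 0" "i = length qs - 1" by (metis mod_self) (use \<open>i + 1 = length qs\<close> in simp)
    consider "l = 0" | "l = i" | "0 < l" "l < i" using l m by linarith
    then show ?thesis
    proof cases
      case 3
      with i pos[of 0 l i] show ?thesis
        unfolding m(1) using cross2_cyclic[of "?q 0" "?q i" "?q l"] by simp
    qed (unfold m(1), simp_all add: cross2_def)
  qed
  show ?thesis
    unfolding support_edge_def using i ne nn mod_less_divisor[of "length qs" "Suc i"]
    by (fastforce simp: in_set_conv_nth)
qed

text \<open>The normal \<open>y\<close> is orthogonal to the unit tangent of the edge, so on the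
  plane its inner product agrees with the cross product with that tangent up to sign. The positive
  gap settles the sign and gives a condition free of \<open>y\<close>.\<close>

lemma next_vertex_gap_coords:
  fixes W :: "'a::euclidean_space set"
  assumes W: "oriented_plane W u v" and T: "T \<subseteq> W" and \<gamma>: "\<gamma> > 0"
    and y: "outer_unit_normal W T (closed_segment p1 p2) y"
    and c: "consecutive_vertices u v T p1 p2 p3"
    and gap: "y \<bullet> p2 - y \<bullet> p3 \<ge> \<gamma>"
  defines "V \<equiv> plane_coords u v ` {q. q extreme_point_of T}"
  shows "no_three_collinear V" "finite V" "p1 \<in> W" "p2 \<in> W"
    "support_edge V (plane_coords u v p1) (plane_coords u v p2)"
    "support_edge V (plane_coords u v p2) (plane_coords u v p3)"
    "plane_coords u v p1 \<noteq> plane_coords u v p3"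
    "\<gamma> \<le> cross2 (sgn (plane_coords u v p2 - plane_coords u v p1)) (plane_coords u v p3 - plane_coords u v p2)"
proof -
  obtain qs i where qs: "clockwise_vertices u v T qs" "i < length qs" "p1 = qs ! i"
    "p2 = qs ! ((i + 1) mod length qs)" "p3 = qs ! ((i + 2) mod length qs)"
    using c by (auto simp: consecutive_vertices_def)
  let ?m = "length qs"
  have setqs: "set qs = {q. q extreme_point_of T}" and dist: "distinct qs"
    using qs by (auto simp: clockwise_vertices_def)
  have Veq: "V = plane_coords u v ` set qs" by (simp add: V_def setqs)
  show fV: "finite V" by (simp add: Veq)
  show V: "no_three_collinear V"
    unfolding Veq by (rule clockwise_vertices_no_three_collinear[OF qs(1)])
  have lt: "(i + 1) mod ?m < ?m" "(i + 2) mod ?m < ?m" using qs(2) by (auto intro: mod_less_divisor)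
  have "p1 \<in> set qs" "p2 \<in> set qs" "p3 \<in> set qs" using qs lt by auto
  then have inT: "p1 \<in> T" "p2 \<in> T" "p3 \<in> T" using setqs by (auto simp: extreme_point_of_def)
  then show inW: "p1 \<in> W" "p2 \<in> W" using T by auto
  have inW3: "p3 \<in> W" using inT T by auto
  have yW: "y \<in> W" "norm y = 1" using y by (auto simp: outer_unit_normal_def)
  \<comment> \<open>Both ends maximise \<open>y\<close> over \<open>T\<close>; the gap then
    separates \<open>p3\<close> from both.\<close>
  have y12: "y \<bullet> p1 = y \<bullet> p2"
    using y inT unfolding outer_unit_normal_def
    by (meson ends_in_segment order_antisym)
  have ne: "p1 \<noteq> p3" "p2 \<noteq> p3" using gap \<gamma> y12 by auto
  \<comment> \<open>A vertex that is its own successor makes the list a singleton, and then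
    \<open>p3 = p2\<close> against the gap.\<close>
  have "p1 \<noteq> p2"
  proof
    assume "p1 = p2"
    then have "i = (i + 1) mod ?m"
      using nth_eq_iff_index_eq[OF dist qs(2) lt(1)] qs(3,4) by metis
    note eq = this
    have "i + 1 = ?m"
    proof (rule ccontr)
      assume "i + 1 \<noteq> ?m"
      with qs(2) have "(i + 1) mod ?m = i + 1" by simp
      with eq show False by linarith
    qed
    with eq have "i = 0" by (metis mod_self)
    with \<open>i + 1 = ?m\<close> have "?m = 1" by simp
    then have "p3 = p2" unfolding qs(4,5) by simp
    with ne show False by simp
  qed
  let ?c = "plane_coords u v"
  have cne: "?c p1 \<noteq> ?c p2" "?c p2 \<noteq> ?c p3" "?c p1 \<noteq> ?c p3"
    using plane_coords_inj[OF W] inW inW3 ne \<open>p1 \<noteq> p2\<close> by blast+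
  show s1: "support_edge V (?c p1) (?c p2)"
    unfolding Veq using clockwise_vertices_support_edge[OF qs(1,2)] cne(1) qs by simp
  have "((i + 1) mod ?m + 1) mod ?m = (i + 2) mod ?m"
    by (simp add: mod_Suc_eq)
  then show s2: "support_edge V (?c p2) (?c p3)"
    unfolding Veq using clockwise_vertices_support_edge[OF qs(1) lt(1)] cne(2) qs by simp
  show "?c p1 \<noteq> ?c p3" by (rule cne)
  define t where "t = sgn (?c p2 - ?c p1)"
  have nt: "norm t = 1" using cne by (simp add: t_def norm_sgn)
  have yc: "y \<bullet> x = ?c y \<bullet> ?c x" if "x \<in> W" for x
    by (rule oriented_plane_inner[OF W yW(1) that])
  have yt: "?c y \<bullet> t = 0"
    using y12 inW by (simp add: t_def sgn_div_norm yc inner_diff_right)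
  \<comment> \<open>the only unit vectors orthogonal to \<open>t\<close> are \<open>\<plusminus>(t\<^sub>2, -t\<^sub>1)\<close>\<close>
  have ny: "norm (?c y) = 1" using oriented_plane_norm[OF W yW(1)] yW by simp
  have "\<bar>?c y \<bullet> (?c p3 - ?c p2)\<bar> = \<bar>cross2 t (?c p3 - ?c p2)\<bar>"
  proof -
    obtain y1 y2 where [simp]: "?c y = (y1, y2)" by (metis prod.exhaust)
    obtain a b where [simp]: "t = (a, b)" by (metis prod.exhaust)
    obtain z1 z2 where [simp]: "?c p3 - ?c p2 = (z1, z2)" by (metis prod.exhaust)
    have "y1 * a + y2 * b = 0" "y1\<^sup>2 + y2\<^sup>2 = 1" "a\<^sup>2 + b\<^sup>2 = 1"
      using yt ny nt by (simp_all add: norm_Pair)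
    note eqs = this
    define c where "c = y1 * b - y2 * a"
    have "y1 * (a\<^sup>2 + b\<^sup>2) = a * (y1 * a + y2 * b) + b * c" "y2 * (a\<^sup>2 + b\<^sup>2) = b * (y1 * a + y2 * b) - a * c"
      by (simp_all add: c_def power2_eq_square algebra_simps)
    then have y: "y1 = b * c" "y2 = - (a * c)" unfolding eqs by simp_all
    have "c\<^sup>2 * (a\<^sup>2 + b\<^sup>2) = y1\<^sup>2 + y2\<^sup>2" by (simp add: y) (simp add: power2_eq_square algebra_simps)
    then have "c = 1 \<or> c = - 1" using eqs by (simp add: power2_eq_1_iff)
    then show ?thesis by (auto simp: cross2_def y)
  qed
  \<comment> \<open>One of the two numbers of equal absolute value is negative and the other is not,
    so they are opposite.\<close>
  moreover have "?c y \<bullet> (?c p3 - ?c p2) \<le> - \<gamma>"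
    using gap inW inW3 by (simp add: yc inner_diff_right)
  moreover have "cross2 t (?c p3 - ?c p2) \<ge> 0"
    using cross2_consecutive_pos[OF V s1 s2 cne(3)] by (simp add: t_def sgn_div_norm)
  ultimately show "\<gamma> \<le> cross2 (sgn (?c p2 - ?c p1)) (?c p3 - ?c p2)"
    unfolding t_def[symmetric] using \<gamma> by linarith
qed

lemma card_gap_edges_le:
  fixes W :: "'a::euclidean_space set" and e :: "'i \<Rightarrow> 'a set"
  assumes W: "oriented_plane W u v" and T: "T \<subseteq> W" and \<gamma>: "\<gamma> > 0" and \<mu>: "\<mu> > 0"
    and R: "\<And>x. x \<in> T \<Longrightarrow> norm x \<le> R" and R0: "0 \<le> R"
    and inj: "inj_on e A"
    and gap: "\<And>i. i \<in> A \<Longrightarrow> \<exists>y p1 p2 p3. outer_unit_normal W T (e i) y \<and> e i = closed_segment p1 p2 \<and>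
        consecutive_vertices u v T p1 p2 p3 \<and> y \<bullet> p2 - y \<bullet> p3 \<ge> \<gamma>"
  shows "real (card A) \<le> 4 * \<mu> + 4 * R / (\<gamma> * \<mu>)"
\<comment> \<open>That \<open>V\<close> is finite and free of collinear triples is drawn from some
  member of \<open>A\<close>, so the empty case is separate.\<close>
proof (cases "A = {}")
  case True
  then show ?thesis using \<gamma> \<mu> R0 by simp
next
  case False
  let ?c = "plane_coords u v"
  define V where "V = ?c ` {q. q extreme_point_of T}"
  define good where "good i p1 p2 p3 \<longleftrightarrow> e i = closed_segment p1 p2 \<and> p1 \<in> W \<and> p2 \<in> W \<and>
      no_three_collinear V \<and> finite V \<and>
      support_edge V (?c p1) (?c p2) \<and> support_edge V (?c p2) (?c p3) \<and> ?c p1 \<noteq> ?c p3 \<and>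
      \<gamma> \<le> cross2 (sgn (?c p2 - ?c p1)) (?c p3 - ?c p2)" for i p1 p2 p3
  have "\<exists>p1 p2 p3. good i p1 p2 p3" if i: "i \<in> A" for i
  proof -
    obtain y p1 p2 p3 where *: "outer_unit_normal W T (e i) y" "e i = closed_segment p1 p2"
        "consecutive_vertices u v T p1 p2 p3" "y \<bullet> p2 - y \<bullet> p3 \<ge> \<gamma>"
      using gap[OF i] by blast
    note ** = next_vertex_gap_coords[OF W T \<gamma> *(1)[unfolded *(2)] *(3,4), folded V_def]
    have "good i p1 p2 p3" unfolding good_def using * ** by blast
    then show ?thesis by blast
  qed
  then obtain P1 P2 P3 where P: "\<And>i. i \<in> A \<Longrightarrow> good i (P1 i) (P2 i) (P3 i)"
    by metis
  note P = P[unfolded good_def]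
  define g where "g i = (?c (P1 i), ?c (P2 i), ?c (P3 i))" for i
  have V: "no_three_collinear V" "finite V" using P False by blast+
  have "inj_on g A"
  proof (rule inj_onI)
    fix i j assume ij: "i \<in> A" "j \<in> A" "g i = g j"
    then have "P1 i = P1 j" "P2 i = P2 j"
      using plane_coords_inj[OF W, of "P1 i" "P1 j"] plane_coords_inj[OF W, of "P2 i" "P2 j"]
        P[OF ij(1)] P[OF ij(2)] unfolding g_def prod.inject by blast+
    moreover have "e i = closed_segment (P1 i) (P2 i)" "e j = closed_segment (P1 j) (P2 j)"
      using P[OF ij(1)] P[OF ij(2)] by blast+
    ultimately have "e i = e j" by metis
    then show "i = j" using ij inj by (blast dest: inj_onD)
  qed
  then have "card A = card (g ` A)" by (simp add: card_image)
  also have "real (card (g ` A)) \<le> 4 * \<mu> + 4 * R / (\<gamma> * \<mu>)"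
  proof (rule card_gap_triples_le[OF V(1) _ _ R0 \<gamma> \<mu>])
    have "g ` A \<subseteq> V \<times> V \<times> V"
      using P unfolding g_def support_edge_def by blast
    then show "finite (g ` A)" using V(2) by (meson finite_SigmaI finite_subset)
    show "norm x \<le> R" if "x \<in> V" for x
    proof -
      obtain z where "x = ?c z" "z \<in> T" using \<open>x \<in> V\<close> by (auto simp: V_def extreme_point_of_def)
      then show ?thesis using R[of z] oriented_plane_norm[OF W, of z] T by auto
    qed
    show "support_edge V p1 p2 \<and> support_edge V p2 p3 \<and> p1 \<noteq> p3 \<and> \<gamma> \<le> cross2 (sgn (p2 - p1)) (p3 - p2)"
      if "(p1, p2, p3) \<in> g ` A" for p1 p2 p3
      using that P unfolding g_def by blast
  qed
  finally show ?thesis .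
qed

section \<open>Plane slices of the convex hull of generic points\<close>

text \<open>No point lies in the affine hull of at most \<open>DIM('a)\<close> points, taken from
  the others and from 0 and \<open>u\<close>. The sets \<open>A\<close> are deterministic and
  \<open>J\<close> omits \<open>i\<close>, so by independence and the densities each clause can hold
  almost surely. The vector \<open>u\<close> represents the plane: a subspace without
  \<open>u\<close> does not contain \<open>W\<close>.\<close>

definition generic_points :: "'a::euclidean_space \<Rightarrow> nat \<Rightarrow> (nat \<Rightarrow> 'a) \<Rightarrow> bool" where
  "generic_points u n x \<longleftrightarrow>
     (\<forall>A\<in>{{}, {0}, {0, u}}. \<forall>i\<in>{1..n}. \<forall>J\<in>Pow ({1..n} - {i}).
        card A + card J \<le> DIM('a) \<longrightarrow> x i \<notin> affine hull (A \<union> x ` J))"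

lemma generic_pointsD:
  fixes x :: "nat \<Rightarrow> 'a::euclidean_space"
  assumes "generic_points u n x" "A \<in> {{}, {0}, {0, u}}" "i \<in> {1..n}" "J \<subseteq> {1..n} - {i}"
    "card A + card J \<le> DIM('a)"
  shows "x i \<notin> affine hull (A \<union> x ` J)"
  using assms unfolding generic_points_def by (metis PowI)

text \<open>Each added point lies off the affine hull of the earlier ones and raises the dimension
  by one.\<close>

lemma generic_points_aff_dim:
  fixes x :: "nat \<Rightarrow> 'a::euclidean_space"
  assumes gen: "generic_points u n x" and "u \<noteq> 0" and A: "A \<in> {{}, {0}, {0, u}}"
    and J: "J \<subseteq> {1..n}" "card A + card J \<le> DIM('a) + 1"
  shows "aff_dim (A \<union> x ` J) = int (card A) + int (card J) - 1"
proof -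
  have "finite J" using J(1) finite_subset by blast
  then show ?thesis using J
  proof (induction J)
    case empty
    show ?case using A \<open>u \<noteq> 0\<close> by (auto simp: aff_dim_2)
  next
    case (insert i J)
    have "x i \<notin> affine hull (A \<union> x ` J)"
      using insert by (intro generic_pointsD[OF gen A]) auto
    then show ?case
      using insert by (simp add: aff_dim_insert)
  qed
qed

lemma generic_points_zero_notin:
  fixes x :: "nat \<Rightarrow> 'a::euclidean_space"
  assumes gen: "generic_points u n x" and u: "u \<noteq> 0"
    and J: "J \<subseteq> {1..n}" "card J \<le> DIM('a)"
  shows "0 \<notin> affine hull (x ` J)"
  using generic_points_aff_dim[OF gen u, of "{0}" J] generic_points_aff_dim[OF gen u, of "{}" J] J
  by (auto simp: aff_dim_insert split: if_splits)

lemma generic_points_notin_span: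
  fixes x :: "nat \<Rightarrow> 'a::euclidean_space"
  assumes gen: "generic_points u n x" and u: "u \<noteq> 0"
    and J: "J \<subseteq> {1..n}" "card J < DIM('a)"
  shows "u \<notin> span (x ` J)"
proof -
  have "aff_dim (insert u (insert 0 (x ` J))) = aff_dim (insert 0 (x ` J)) + 1"
    using generic_points_aff_dim[OF gen u, of "{0}" J] generic_points_aff_dim[OF gen u, of "{0, u}" J] J u
    by (simp add: insert_commute)
  then have "u \<notin> affine hull (insert 0 (x ` J))"
    by (auto simp: aff_dim_insert split: if_splits)
  then show ?thesis
    by (metis affine_hull_span_0 hull_inc insertI1 span_insert_0)
qed

lemma generic_points_notin_affine_hull:
  fixes x :: "nat \<Rightarrow> 'a::euclidean_space"
  assumes "generic_points u n x" "i \<in> {1..n}" "I \<subseteq> {1..n}" "card I \<le> DIM('a)" "i \<notin> I"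
  shows "x i \<notin> affine hull (x ` I)"
  using generic_pointsD[OF assms(1), of "{}" i I] assms by auto

text \<open>A two-dimensional part would span \<open>W\<close> affinely, and \<open>L\<close> would
  contain the origin.\<close>

lemma aff_dim_plane_slice_le:
  fixes W :: "'a::euclidean_space set"
  assumes "subspace W" "dim W = 2" "affine L" "0 \<notin> L" "S \<subseteq> L \<inter> W"
  shows "aff_dim S \<le> 1"
proof (rule ccontr)
  assume "\<not> aff_dim S \<le> 1"
  moreover have "aff_dim S \<le> aff_dim W" using assms by (intro aff_dim_subset) auto
  moreover have "aff_dim W = 2" using assms by (simp add: aff_dim_subspace)
  ultimately have "aff_dim S = aff_dim W" by linarith
  moreover have "S \<noteq> {}" using \<open>\<not> aff_dim S \<le> 1\<close> by auto
  moreover have "affine hull S \<subseteq> W" using assms subspace_imp_affine by (intro hull_minimal) auto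
  ultimately have "affine hull S = W"
    using assms subspace_imp_affine by (intro affine_dim_equal) auto
  moreover have "affine hull S \<subseteq> L" using assms by (intro hull_minimal) auto
  ultimately show False using assms subspace_0 by blast
qed

lemma edges_le_one:
  fixes T :: "'a::euclidean_space set"
  assumes "convex T" "aff_dim T \<le> 1"
  shows "edges T \<le> 1"
proof -
  have "{e. e edge_of T} \<subseteq> {T}"
    using face_of_aff_dim_lt[OF assms(1)] assms(2) by (force simp: edge_of_def)
  then have "card {e. e edge_of T} \<le> card {T}" by (intro card_mono) auto
  then show ?thesis by (simp add: edges_def)
qed

text \<open>A facet is the hull of some of the points. The polytope has full dimension, so their
  affine dimension is \<open>DIM('a) - 1\<close>: this takes at least \<open>DIM('a)\<close> points,
  and one more generic point would already span the space.\<close>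

lemma generic_points_facet:
  fixes x :: "nat \<Rightarrow> 'a::euclidean_space"
  assumes gen: "generic_points u n x" and u: "u \<noteq> 0" and n: "n > DIM('a)"
    and F: "F facet_of convex hull (x ` {1..n})"
  shows "\<exists>I\<subseteq>{1..n}. card I = DIM('a) \<and> F = convex hull (x ` I)"
proof -
  have full: "DIM('a) \<le> aff_dim (x ` I)" if I: "I \<subseteq> {1..n}" "card I \<ge> DIM('a) + 1" for I
  proof -
    obtain K where K: "K \<subseteq> I" "card K = DIM('a) + 1"
      using I(2) by (meson obtain_subset_with_card_n)
    then have "aff_dim (x ` K) = DIM('a)"
      using generic_points_aff_dim[OF gen u, of "{}" K] I by auto
    then show ?thesis using aff_dim_subset[of "x ` K" "x ` I"] K by auto
  qed
  have "aff_dim (x ` {1..n}) = DIM('a)"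
    using full[of "{1..n}"] n aff_dim_le_DIM[of "x ` {1..n}"] by simp
  then have dimF: "aff_dim F = int (DIM('a)) - 1"
    using F by (simp add: facet_of_def aff_dim_convex_hull)
  obtain S where S: "S \<subseteq> x ` {1..n}" "F = convex hull S"
    using F face_of_convex_hull_subset[of "x ` {1..n}" F]
    by (auto simp: facet_of_def finite_imp_compact)
  define I where "I = {i \<in> {1..n}. x i \<in> S}"
  have xI: "x ` I = S" using S by (auto simp: I_def)
  have I: "I \<subseteq> {1..n}" by (auto simp: I_def)
  then have finI: "finite I" using finite_subset by blast
  have d: "aff_dim (x ` I) = int (DIM('a)) - 1" using dimF by (simp add: S xI aff_dim_convex_hull)
  have "card I \<ge> DIM('a)"
    using d aff_dim_le_card[of "x ` I"] card_image_le[OF finI, of x] finI by auto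
  moreover have "\<not> card I \<ge> DIM('a) + 1" using full[OF I] d by auto
  ultimately show ?thesis using I S xI by (intro exI[of _ I]) auto
qed

text \<open>A relative interior point \<open>z\<close> of the edge lies on the boundary of the
  polytope, hence on a facet \<open>F\<close>. The slice of \<open>F\<close> is a face that contains
  \<open>e\<close> and is at most one-dimensional, so it equals \<open>e\<close>.\<close>

lemma generic_points_edge:
  fixes x :: "nat \<Rightarrow> 'a::euclidean_space"
  assumes gen: "generic_points u n x" and u: "u \<noteq> 0" and n: "n > DIM('a)"
    and W: "subspace W" "dim W = 2"
    and e: "e edge_of convex hull (x ` {1..n}) \<inter> W"
  shows "\<exists>I\<subseteq>{1..n}. card I = DIM('a) \<and> facet_event W n x I \<and> e = convex hull (x ` I) \<inter> W"
proof -
  let ?P = "convex hull (x ` {1..n})"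
  have face: "e face_of ?P \<inter> W" and dim1: "aff_dim e = 1" using e by (auto simp: edge_of_def)
  have cW: "convex W" "affine W" using W by (auto simp: subspace_imp_convex subspace_imp_affine)
  have ce: "convex e" using face by (rule face_of_imp_convex)
  have "e \<noteq> {}" using dim1 by auto
  then obtain z where z: "z \<in> rel_interior e" using rel_interior_eq_empty ce by blast
  then have ze: "z \<in> e" using rel_interior_subset by blast
  then have zP: "z \<in> ?P" "z \<in> W" using face_of_imp_subset[OF face] by auto
  \<comment> \<open>Otherwise \<open>z\<close> would be relatively interior to the slice, and
    \<open>e\<close> would be the whole two-dimensional slice.\<close>
  have "z \<notin> interior ?P"
  proof
    assume zi: "z \<in> interior ?P"
    then have ne: "W \<inter> interior ?P \<noteq> {}" using zP by blast
    have aff: "affine hull (?P \<inter> W) = W"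
      using affine_hull_affine_Int_nonempty_interior[OF cW(2) ne] cW(2) by (simp add: Int_commute hull_same)
    have "z \<in> rel_interior (?P \<inter> W)"
      using zi zP unfolding mem_rel_interior aff
      by (intro exI[of _ "interior ?P"] conjI) (use interior_subset in auto)
    then have "e = ?P \<inter> W" using face_of_disjoint_rel_interior[OF face] ze by blast
    then have "aff_dim e = aff_dim W" using aff by (metis aff_dim_affine_hull)
    with dim1 W show False by (simp add: aff_dim_subspace)
  qed
  then have "z \<in> ?P - rel_interior ?P"
  proof -
    obtain K where K: "K \<subseteq> {1..n}" "card K = DIM('a) + 1"
      using n obtain_subset_with_card_n[of "DIM('a) + 1" "{1..n}"] by auto
    have "aff_dim (x ` K) \<le> aff_dim ?P"
      unfolding aff_dim_convex_hull using K by (intro aff_dim_subset) auto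
    moreover have "aff_dim (x ` K) = int (DIM('a))"
      using generic_points_aff_dim[OF gen u, of "{}" K] K by auto
    ultimately have "aff_dim ?P = int (DIM('a))"
      using aff_dim_le_DIM[of ?P] by linarith
    then have "rel_interior ?P = interior ?P"
      by (simp add: aff_dim_eq_full rel_interior_interior)
    with \<open>z \<notin> interior ?P\<close> zP show ?thesis by auto
  qed
  then obtain F where F: "F facet_of ?P" "z \<in> F"
    using rel_boundary_of_polyhedron[of ?P] by (auto simp: polyhedron_convex_hull)
  obtain I where I: "I \<subseteq> {1..n}" "card I = DIM('a)" "F = convex hull (x ` I)"
    using generic_points_facet[OF gen u n F(1)] by blast
  have FW: "F \<inter> W face_of ?P \<inter> W"
    using F cW by (intro face_of_slice) (auto simp: facet_of_def)
  \<comment> \<open>A face that contains a relative interior point of \<open>e\<close> contains all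
    of \<open>e\<close>.\<close>
  have sub: "e \<subseteq> F \<inter> W"
    using subset_of_face_of[OF FW face_of_imp_subset[OF face]] z F zP by blast
  have "e face_of F \<inter> W"
    using face sub face_of_subset[of e "?P \<inter> W" "F \<inter> W"] face_of_imp_subset[OF FW] by blast
  moreover have "aff_dim (F \<inter> W) \<le> 1"
  proof (rule aff_dim_plane_slice_le[OF W])
    show "0 \<notin> affine hull (x ` I)" using generic_points_zero_notin[OF gen u I(1)] I by simp
    show "F \<inter> W \<subseteq> affine hull (x ` I) \<inter> W" using I convex_hull_subset_affine_hull by blast
  qed auto
  ultimately have "e = F \<inter> W"
    using face_of_aff_dim_lt[of "F \<inter> W" e] dim1 face_of_imp_convex[OF FW] by linarith
  then show ?thesis
    using I F zP by (intro exI[of _ I]) (auto simp: facet_event_def)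
qed

lemma generic_points_edges_le:
  fixes x :: "nat \<Rightarrow> 'a::euclidean_space"
  assumes gen: "generic_points u n x" and u: "u \<noteq> 0" and n: "n > DIM('a)"
    and W: "subspace W" "dim W = 2"
  shows "edges (convex hull (x ` {1..n}) \<inter> W) \<le> card {I. I \<subseteq> {1..n} \<and> card I = DIM('a) \<and> facet_event W n x I}"
    (is "_ \<le> card ?A")
proof -
  have fin: "finite ?A" by (rule finite_subset[of _ "Pow {1..n}"]) auto
  have "{e. e edge_of convex hull (x ` {1..n}) \<inter> W} \<subseteq> (\<lambda>I. convex hull (x ` I) \<inter> W) ` ?A"
    using generic_points_edge[OF gen u n W] by blast
  then show ?thesis unfolding edges_def using fin by (rule surj_card_le[rotated])
qed

text \<open>With so few points the affine hull misses the origin, so the slice is at most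
  one-dimensional; this case is settled without facet events.\<close>

lemma generic_points_small_edges_le:
  fixes x :: "nat \<Rightarrow> 'a::euclidean_space"
  assumes gen: "generic_points u n x" and u: "u \<noteq> 0" and n: "n \<le> DIM('a)"
    and W: "subspace W" "dim W = 2"
  shows "edges (convex hull (x ` {1..n}) \<inter> W) \<le> 1"
proof (rule edges_le_one)
  show "convex (convex hull (x ` {1..n}) \<inter> W)"
    using W by (simp add: convex_Int subspace_imp_convex)
  show "aff_dim (convex hull (x ` {1..n}) \<inter> W) \<le> 1"
  proof (rule aff_dim_plane_slice_le[OF W])
    show "0 \<notin> affine hull (x ` {1..n})" using generic_points_zero_notin[OF gen u] n by simp
    show "convex hull (x ` {1..n}) \<inter> W \<subseteq> affine hull (x ` {1..n}) \<inter> W"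
      using convex_hull_subset_affine_hull by blast
  qed auto
qed

text \<open>Two facets meet in a face, which by genericity is spanned by points with indices in both
  \<open>I\<close> and \<open>J\<close>. If these are fewer than \<open>DIM('a)\<close> points,
  their span cannot contain the plane, whereas two distinct points of a common slice would force it
  to.\<close>

lemma generic_points_slice_inj:
  fixes x :: "nat \<Rightarrow> 'a::euclidean_space"
  assumes gen: "generic_points u n x" and u: "u \<noteq> 0"
    and W: "subspace W" "dim W = 2" "u \<in> W"
    and I: "I \<subseteq> {1..n}" "card I = DIM('a)" "facet_event W n x I"
    and J: "J \<subseteq> {1..n}" "card J = DIM('a)" "facet_event W n x J"
    and eq: "convex hull (x ` I) \<inter> W = convex hull (x ` J) \<inter> W"
    and p: "p \<in> convex hull (x ` I) \<inter> W" "q \<in> convex hull (x ` I) \<inter> W" "p \<noteq> q"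
  shows "I = J"
proof (rule ccontr)
  assume "I \<noteq> J"
  define K where "K = I \<inter> J"
  have fin: "finite I" "finite J" using I J finite_subset by blast+
  have K: "K \<subseteq> {1..n}" "card K < DIM('a)"
  proof -
    show "K \<subseteq> {1..n}" using I by (auto simp: K_def)
    have "\<not> I \<subseteq> J" using \<open>I \<noteq> J\<close> card_subset_eq[OF fin(2)] I(2) J(2) by metis
    then have "K \<subset> I" by (auto simp: K_def)
    then show "card K < DIM('a)" using psubset_card_mono[OF fin(1)] I by simp
  qed
  let ?F = "convex hull (x ` I) \<inter> convex hull (x ` J)"
  have "?F face_of convex hull (x ` {1..n})"
    using I J by (intro face_of_Int) (auto simp: facet_event_def facet_of_def)
  then obtain S where S: "S \<subseteq> x ` {1..n}" "?F = convex hull S"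
    using face_of_convex_hull_subset[of "x ` {1..n}" ?F] by (auto simp: finite_imp_compact)
  have "S \<subseteq> x ` K"
  \<comment> \<open>A point of \<open>S\<close> lies in both affine hulls, so by genericity its
    index lies in \<open>I\<close> and in \<open>J\<close>.\<close>
  proof
    fix s assume "s \<in> S"
    then obtain k where k: "k \<in> {1..n}" "s = x k" using S by blast
    moreover have "s \<in> ?F" unfolding S(2) using \<open>s \<in> S\<close> by (rule hull_inc)
    ultimately have "x k \<in> affine hull (x ` I)" "x k \<in> affine hull (x ` J)"
      using convex_hull_subset_affine_hull by blast+
    then have "k \<in> I" "k \<in> J"
      using generic_points_notin_affine_hull[OF gen k(1), of I] I
        generic_points_notin_affine_hull[OF gen k(1), of J] J by auto
    then show "s \<in> x ` K" using k by (auto simp: K_def)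
  qed
  then have "?F \<subseteq> affine hull (x ` K)"
    using S convex_hull_subset_affine_hull by (metis hull_mono order_trans)
  then have pq: "{p, q} \<subseteq> affine hull (x ` K)" "{p, q} \<subseteq> W" using p eq by auto
  have "0 \<notin> affine hull {p, q}"
    using generic_points_zero_notin[OF gen u K(1)] K(2) hull_minimal[OF pq(1), of affine] by auto
  then have "aff_dim {0, p, q} = 2" using p(3) by (simp add: aff_dim_insert[of 0] aff_dim_2)
  moreover have "affine hull {0, p, q} \<subseteq> W"
    using pq W subspace_imp_affine subspace_0 by (intro hull_minimal) auto
  ultimately have "affine hull {0, p, q} = W"
    using W subspace_imp_affine by (intro affine_dim_equal) (auto simp: aff_dim_subspace)
  moreover have "affine hull {0, p, q} \<subseteq> span (x ` K)"
    using pq affine_hull_subset_span[of "x ` K"] subspace_imp_affine span_zero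
    by (intro hull_minimal) auto
  ultimately show False
    using generic_points_notin_span[OF gen u K] W by blast
qed

section \<open>Projection onto the plane and the count of facets with a gap\<close>

lemma orth_proj_oriented_plane:
  fixes W :: "'a::euclidean_space set"
  assumes W: "oriented_plane W u v"
  shows "orth_proj W x = (x \<bullet> u) *\<^sub>R u + (x \<bullet> v) *\<^sub>R v" (is "_ = ?p")
proof -
  have o: "subspace W" "u \<in> W" "v \<in> W" "u \<bullet> u = 1" "v \<bullet> v = 1" "u \<bullet> v = 0" "v \<bullet> u = 0"
    using W by (auto simp: oriented_plane_def orthogonal_def norm_eq_1 inner_commute)
  have pW: "?p \<in> W" using o by (intro subspace_add subspace_scale) auto
  have orth: "orthogonal (x - ?p) w" if "w \<in> W" for w
  proof -
    have "(x - ?p) \<bullet> u = 0" "(x - ?p) \<bullet> v = 0"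
      using o by (simp_all add: inner_diff_left inner_add_left)
    then have "(x - ?p) \<bullet> ((w \<bullet> u) *\<^sub>R u + (w \<bullet> v) *\<^sub>R v) = 0"
      by (simp only: inner_add_right inner_scaleR_right)
    then show ?thesis unfolding orthogonal_def using oriented_plane_expand[OF W that] by simp
  qed
  show ?thesis
    unfolding orth_proj_def
  proof (rule the_equality)
    show "?p \<in> W \<and> (\<forall>w\<in>W. orthogonal (x - ?p) w)" using pW orth by blast
    fix p assume p: "p \<in> W \<and> (\<forall>w\<in>W. orthogonal (x - p) w)"
    have "p - ?p \<in> W" using p pW o by (intro subspace_diff) auto
    then have "(x - ?p) \<bullet> (p - ?p) = 0" "(x - p) \<bullet> (p - ?p) = 0"
      using p orth unfolding orthogonal_def by blast+
    then have "(p - ?p) \<bullet> (p - ?p) = 0"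
      by (metis (no_types, lifting) diff_diff_eq2 diff_self diff_add_cancel inner_diff_left add_diff_cancel_left')
    then show "p = ?p" by simp
  qed
qed

lemma norm_orth_proj_oriented_plane:
  fixes W :: "'a::euclidean_space set"
  assumes W: "oriented_plane W u v"
  shows "norm (orth_proj W x) = norm (plane_coords u v x)"
proof -
  have o: "subspace W" "u \<in> W" "v \<in> W" "u \<bullet> u = 1" "v \<bullet> v = 1" "u \<bullet> v = 0" "v \<bullet> u = 0"
    using W by (auto simp: oriented_plane_def orthogonal_def norm_eq_1 inner_commute)
  have "orth_proj W x \<in> W"
    unfolding orth_proj_oriented_plane[OF W] using o by (intro subspace_add subspace_scale) auto
  moreover have "plane_coords u v (orth_proj W x) = plane_coords u v x"
    unfolding orth_proj_oriented_plane[OF W] using o by (simp add: plane_coords_def inner_add_left)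
  ultimately show ?thesis using oriented_plane_norm[OF W] by metis
qed

text \<open>The points whose projection has norm at most \<open>?R\<close> form a convex set that
  contains every \<open>x i\<close>, hence their hull; on \<open>W\<close> the projection preserves
  norms.\<close>

lemma norm_slice_le_Max:
  fixes x :: "nat \<Rightarrow> 'a::euclidean_space"
  assumes W: "oriented_plane W u v" and z: "z \<in> convex hull (x ` {1..n}) \<inter> W"
  shows "norm z \<le> (MAX i\<in>{1..n}. norm (orth_proj W (x i)))" (is "_ \<le> ?R")
proof -
  have lin: "linear (plane_coords u v)"
    by (rule linearI) (auto simp: plane_coords_def inner_add_left)
  have "x i \<in> plane_coords u v -` cball 0 ?R" if "i \<in> {1..n}" for i
  proof -
    have "norm (orth_proj W (x i)) \<le> ?R" using that by (intro Max_ge) auto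
    then show ?thesis by (simp add: norm_orth_proj_oriented_plane[OF W])
  qed
  then have "convex hull (x ` {1..n}) \<subseteq> plane_coords u v -` cball 0 ?R"
    by (intro hull_minimal convex_linear_vimage lin) auto
  with z have "norm (plane_coords u v z) \<le> ?R" by auto
  then show ?thesis using oriented_plane_norm[OF W] z by auto
qed

lemma card_gap_facets_le:
  fixes x :: "nat \<Rightarrow> 'a::euclidean_space"
  assumes gen: "generic_points u n x" and W: "oriented_plane W u v" and n: "n \<ge> 1"
    and \<gamma>: "\<gamma> > 0" and \<mu>: "\<mu> > 0"
  shows "real (card {I. I \<subseteq> {1..n} \<and> card I = DIM('a) \<and> facet_event W n x I \<and> next_vertex_gap W u v n x I \<gamma>})
    \<le> 4 * \<mu> + 4 * (MAX i\<in>{1..n}. norm (orth_proj W (x i))) / (\<gamma> * \<mu>)" (is "real (card ?A) \<le> _")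
proof (rule card_gap_edges_le[OF W _ \<gamma> \<mu>])
  let ?T = "convex hull (x ` {1..n}) \<inter> W" and ?e = "\<lambda>I. convex hull (x ` I) \<inter> W"
  show TW: "?T \<subseteq> W" by blast
  show "norm z \<le> (MAX i\<in>{1..n}. norm (orth_proj W (x i)))" if "z \<in> ?T" for z
    using norm_slice_le_Max[OF W that] .
  have "norm (orth_proj W (x 1)) \<le> (MAX i\<in>{1..n}. norm (orth_proj W (x i)))"
    using n by (intro Max_ge) auto
  then show "0 \<le> (MAX i\<in>{1..n}. norm (orth_proj W (x i)))"
    using norm_ge_zero order_trans by blast
  show gap: "\<exists>y p1 p2 p3. outer_unit_normal W ?T (?e I) y \<and> ?e I = closed_segment p1 p2 \<and>
        consecutive_vertices u v ?T p1 p2 p3 \<and> \<gamma> \<le> y \<bullet> p2 - y \<bullet> p3" if "I \<in> ?A" for I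
    using that by (simp add: next_vertex_gap_def Let_def)
  \<comment> \<open>The gap makes the ends \<open>p1\<close> and \<open>p2\<close> distinct, and a
    slice with two distinct points determines its index set.\<close>
  show "inj_on ?e ?A"
  proof (rule inj_onI)
    fix I J assume I: "I \<in> ?A" and J: "J \<in> ?A" and eq: "?e I = ?e J"
    obtain y p1 p2 p3 where *: "outer_unit_normal W ?T (?e I) y" "?e I = closed_segment p1 p2"
        "consecutive_vertices u v ?T p1 p2 p3" "\<gamma> \<le> y \<bullet> p2 - y \<bullet> p3"
      using gap[OF I] by blast
    note next_vertex_gap_coords(5)[OF W TW \<gamma> *(1)[unfolded *(2)] *(3,4)]
    then have "p1 \<noteq> p2" by (auto simp: support_edge_def)
    moreover have "p1 \<in> ?e I" "p2 \<in> ?e I" unfolding *(2) by auto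
    moreover have "subspace W" "dim W = 2" "u \<in> W" "u \<noteq> 0" using W by (auto simp: oriented_plane_def)
    ultimately show "I = J"
      using I J eq by (intro generic_points_slice_inj[OF gen, of W I J p1 p2]) auto
  qed
qed

section \<open>Measurability of the facet events\<close>

text \<open>The coefficients are indexed by \<open>I\<close> and not by the points, so the formula
  also covers configurations in which points coincide.\<close>

lemma affine_hull_image_finite:
  fixes g :: "'i \<Rightarrow> 'a::real_vector"
  assumes "finite I"
  shows "affine hull (g ` I) = {\<Sum>i\<in>I. c i *\<^sub>R g i | c. sum c I = 1}" (is "_ = ?S")
proof
  have "affine ?S"
    unfolding affine_def
  proof (intro ballI allI impI)
    fix x y and a b :: real assume "x \<in> ?S" "y \<in> ?S" and ab: "a + b = 1"
    then obtain c d where c: "sum c I = 1" "x = (\<Sum>i\<in>I. c i *\<^sub>R g i)"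
      and d: "sum d I = 1" "y = (\<Sum>i\<in>I. d i *\<^sub>R g i)" by blast
    have "a *\<^sub>R x + b *\<^sub>R y = (\<Sum>i\<in>I. (a * c i + b * d i) *\<^sub>R g i)"
      by (simp add: c d scaleR_sum_right sum.distrib scaleR_add_left)
    moreover have "(\<Sum>i\<in>I. a * c i + b * d i) = 1"
      using ab c d by (simp add: sum.distrib flip: sum_distrib_left)
    ultimately show "a *\<^sub>R x + b *\<^sub>R y \<in> ?S"
      by (intro CollectI exI[of _ "\<lambda>i. a * c i + b * d i"]) auto
  qed
  moreover have "g ` I \<subseteq> ?S"
  proof
    fix x assume "x \<in> g ` I"
    then obtain i where i: "i \<in> I" "x = g i" by blast
    then have "x = (\<Sum>j\<in>I. (if j = i then 1 else 0) *\<^sub>R g j)"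
      using assms by (simp add: if_distrib[of "\<lambda>r. r *\<^sub>R _"] cong: if_cong)
    moreover have "(\<Sum>j\<in>I. (if j = i then 1 else 0 :: real)) = 1" using i assms by simp
    ultimately show "x \<in> ?S"
      by (intro CollectI exI[of _ "\<lambda>j. if j = i then 1 else 0"]) auto
  qed
  ultimately show "affine hull (g ` I) \<subseteq> ?S" by (intro hull_minimal)
  show "?S \<subseteq> affine hull (g ` I)"
  proof
    fix x assume "x \<in> ?S"
    then obtain c where c: "sum c I = 1" "x = (\<Sum>i\<in>I. c i *\<^sub>R g i)" by blast
    obtain i0 where i0: "i0 \<in> I" using c(1) by fastforce
    \<comment> \<open>Subtracting \<open>g i0\<close> turns the affine hull into a subspace, where
      arbitrary linear combinations are available.\<close>
    have "subspace ((\<lambda>y. y - g i0) ` (affine hull (g ` I)))"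
      using i0 by (intro affine_diffs_subspace_subtract) (auto simp: hull_inc)
    then have "(\<Sum>i\<in>I. c i *\<^sub>R (g i - g i0)) \<in> (\<lambda>y. y - g i0) ` (affine hull (g ` I))"
      by (intro subspace_sum subspace_scale imageI) (auto simp: hull_inc)
    moreover have "x = (\<Sum>i\<in>I. c i *\<^sub>R (g i - g i0)) + g i0"
      using c by (simp add: scaleR_diff_right sum_subtractf flip: scaleR_sum_left)
    ultimately show "x \<in> affine hull (g ` I)" by auto
  qed
qed

lemma convex_hull_image_finite:
  fixes g :: "'i \<Rightarrow> 'a::real_vector"
  assumes "finite I"
  shows "convex hull (g ` I) = {\<Sum>i\<in>I. c i *\<^sub>R g i | c. (\<forall>i\<in>I. 0 \<le> c i) \<and> sum c I = 1}" (is "_ = ?S")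
proof
  have "convex ?S"
    unfolding convex_def
  proof (intro ballI allI impI)
    fix x y and a b :: real assume "x \<in> ?S" "y \<in> ?S" and ab: "0 \<le> a" "0 \<le> b" "a + b = 1"
    then obtain c d where c: "sum c I = 1" "x = (\<Sum>i\<in>I. c i *\<^sub>R g i)" "\<forall>i\<in>I. 0 \<le> c i"
      and d: "sum d I = 1" "y = (\<Sum>i\<in>I. d i *\<^sub>R g i)" "\<forall>i\<in>I. 0 \<le> d i" by blast
    have "a *\<^sub>R x + b *\<^sub>R y = (\<Sum>i\<in>I. (a * c i + b * d i) *\<^sub>R g i)"
      by (simp add: c d scaleR_sum_right sum.distrib scaleR_add_left)
    moreover have "(\<Sum>i\<in>I. a * c i + b * d i) = 1"
      using ab c d by (simp add: sum.distrib flip: sum_distrib_left)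
    ultimately show "a *\<^sub>R x + b *\<^sub>R y \<in> ?S"
      using ab c(3) d(3) by (intro CollectI exI[of _ "\<lambda>i. a * c i + b * d i"]) auto
  qed
  moreover have "g ` I \<subseteq> ?S"
  proof
    fix x assume "x \<in> g ` I"
    then obtain i where i: "i \<in> I" "x = g i" by blast
    then have "x = (\<Sum>j\<in>I. (if j = i then 1 else 0) *\<^sub>R g j)"
      using assms by (simp add: if_distrib[of "\<lambda>r. r *\<^sub>R _"] cong: if_cong)
    moreover have "(\<Sum>j\<in>I. (if j = i then 1 else 0 :: real)) = 1" using i assms by simp
    ultimately show "x \<in> ?S"
      by (intro CollectI exI[of _ "\<lambda>j. if j = i then 1 else 0"]) auto
  qed
  ultimately show "convex hull (g ` I) \<subseteq> ?S" by (intro hull_minimal)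
  show "?S \<subseteq> convex hull (g ` I)"
      proof
    fix x assume "x \<in> ?S"
    then obtain c where "\<forall>i\<in>I. 0 \<le> c i" "sum c I = 1" "x = (\<Sum>i\<in>I. c i *\<^sub>R g i)" by blast
    then show "x \<in> convex hull (g ` I)"
      using assms convex_sum[of I "convex hull (g ` I)" c g] by (simp add: hull_inc)
  qed
qed

text \<open>A compact and a closed set meet iff their distance is 0, and the distance can be computed with
  coefficients from a countable dense set.\<close>

lemma pred_convex_hull_meets_affine_hull:
  fixes f :: "'k::countable \<Rightarrow> 'w \<Rightarrow> 'a::euclidean_space" and g :: "'i::countable \<Rightarrow> 'w \<Rightarrow> 'a"
  assumes fin: "finite K" "finite I"
    and f: "\<And>k. k \<in> K \<Longrightarrow> f k \<in> borel_measurable M"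
    and g: "\<And>i. i \<in> I \<Longrightarrow> g i \<in> borel_measurable M"
  shows "Measurable.pred M
    (\<lambda>\<omega>. convex hull ((\<lambda>k. f k \<omega>) ` K) \<inter> affine hull ((\<lambda>i. g i \<omega>) ` I) \<noteq> {})"
proof -
  \<comment> \<open>Coefficient families of the convex combinations over \<open>K\<close> and the
    affine combinations over \<open>I\<close>. With countable index types the function spaces are
    second countable, which supplies \<open>D\<close>.\<close>
  define C :: "(('k \<Rightarrow> real) \<times> ('i \<Rightarrow> real)) set" where
    "C = {(s, t). (\<forall>k\<in>K. 0 \<le> s k) \<and> sum s K = 1 \<and> sum t I = 1}"
  obtain D where D: "countable D" "D \<subseteq> C" "C \<subseteq> closure D" by (rule separable)
  define H where "H \<omega> c = norm ((\<Sum>k\<in>K. fst c k *\<^sub>R f k \<omega>) - (\<Sum>i\<in>I. snd c i *\<^sub>R g i \<omega>))"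
    for \<omega> and c :: "('k \<Rightarrow> real) \<times> ('i \<Rightarrow> real)"
  have iff: "convex hull ((\<lambda>k. f k \<omega>) ` K) \<inter> affine hull ((\<lambda>i. g i \<omega>) ` I) \<noteq> {} \<longleftrightarrow>
      (\<forall>m::nat. \<exists>c\<in>D. H \<omega> c < 1 / real (Suc m))" (is "?X \<inter> ?Y \<noteq> {} \<longleftrightarrow> _") for \<omega>
  proof
    assume "?X \<inter> ?Y \<noteq> {}"
    then obtain z where "z \<in> ?X" "z \<in> ?Y" by blast
    then obtain s t where "\<forall>k\<in>K. 0 \<le> s k" "sum s K = 1" "z = (\<Sum>k\<in>K. s k *\<^sub>R f k \<omega>)"
      "sum t I = 1" "z = (\<Sum>i\<in>I. t i *\<^sub>R g i \<omega>)"
      unfolding convex_hull_image_finite[OF fin(1)] affine_hull_image_finite[OF fin(2)] by blast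
    then have c0: "(s, t) \<in> C" "H \<omega> (s, t) = 0" by (simp_all add: C_def H_def)
    \<comment> \<open>By continuity in the coefficients, the value 0 at \<open>(s, t)\<close> is
      approached along \<open>D\<close>.\<close>
    have cont: "continuous_on UNIV (H \<omega>)"
      unfolding H_def
      by (intro continuous_intros continuous_on_compose2[OF continuous_on_product_coordinates]) auto
    show "\<forall>m::nat. \<exists>c\<in>D. H \<omega> c < 1 / real (Suc m)"
    proof
      fix m :: nat
      have "open {c. H \<omega> c < 1 / real (Suc m)}"
        by (intro open_Collect_less cont continuous_intros)
      moreover have "(s, t) \<in> {c. H \<omega> c < 1 / real (Suc m)} \<inter> closure D"
        using c0 D by auto
      ultimately show "\<exists>c\<in>D. H \<omega> c < 1 / real (Suc m)"
        using open_Int_closure_eq_empty by blast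
    qed
  next
    assume R: "\<forall>m::nat. \<exists>c\<in>D. H \<omega> c < 1 / real (Suc m)"
    show "?X \<inter> ?Y \<noteq> {}"
    proof
      assume "?X \<inter> ?Y = {}"
      then obtain \<delta> where \<delta>: "\<delta> > 0" "\<forall>x\<in>?X. \<forall>y\<in>?Y. \<delta> \<le> dist x y"
        using separate_compact_closed[of ?X ?Y] fin
        by (auto simp: finite_imp_compact_convex_hull closed_affine_hull)
      obtain m where m: "1 / real (Suc m) < \<delta>"
        using \<delta>(1) reals_Archimedean by (auto simp: inverse_eq_divide)
      obtain c where c: "c \<in> D" "H \<omega> c < 1 / real (Suc m)" using R by blast
      have "c \<in> C" using c(1) D(2) by blast
      then have "\<forall>k\<in>K. 0 \<le> fst c k" "sum (fst c) K = 1" "sum (snd c) I = 1" by (auto simp: C_def)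
      then have "(\<Sum>k\<in>K. fst c k *\<^sub>R f k \<omega>) \<in> ?X" "(\<Sum>i\<in>I. snd c i *\<^sub>R g i \<omega>) \<in> ?Y"
        unfolding convex_hull_image_finite[OF fin(1)] affine_hull_image_finite[OF fin(2)] by blast+
      then have "\<delta> \<le> H \<omega> c" using \<delta>(2) by (simp add: H_def dist_norm)
      with c m show False by linarith
    qed
  qed
  have "(\<lambda>\<omega>. H \<omega> c) \<in> borel_measurable M" for c
    unfolding H_def using f g by (auto intro!: measurable_compose[OF _ borel_measurable_norm] borel_measurable_diff borel_measurable_sum borel_measurable_scaleR)
  then show ?thesis
    unfolding iff using D(1)
    by (intro pred_intros_countable(1) pred_intros_countable_bounded) (auto intro!: borel_measurable_less simp: pred_def)
qed

text \<open>A face that meets the open part of a segment contains both ends, so a segment with ends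
  off the face never enters it.\<close>

lemma convex_Diff_face_of:
  fixes S :: "'a::real_normed_vector set"
  assumes "convex S" "F face_of S"
  shows "convex (S - F)"
  unfolding convex_contains_segment
proof (intro ballI subsetI)
  fix a b z assume ab: "a \<in> S - F" "b \<in> S - F" and z: "z \<in> closed_segment a b"
  have "z \<notin> F"
  proof
    assume "z \<in> F"
    then have "z \<in> open_segment a b" using ab z by (auto simp: open_segment_def)
    then have "a \<in> F" using assms(2) ab \<open>z \<in> F\<close> unfolding face_of_def by blast
    with ab show False by blast
  qed
  moreover have "z \<in> S" using ab z \<open>convex S\<close> by (meson DiffD1 closed_segment_subset subsetD)
  ultimately show "z \<in> S - F" by blast
qed

text \<open>\<open>K\<close> collects the indices of all points in the face; the remaining points
  lie in the convex set \<open>?S - ?F\<close>, which misses the affine hull of \<open>?F\<close>.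
  The right side combines finitely many conditions on a convex hull meeting an affine hull, which is
  the form known to be measurable.\<close>

lemma convex_hull_face_of_convex_hull_iff:
  fixes x :: "'i \<Rightarrow> 'a::euclidean_space"
  assumes "finite N" "I \<subseteq> N"
  shows "convex hull (x ` I) face_of convex hull (x ` N) \<longleftrightarrow>
    (\<exists>K\<in>Pow N. I \<subseteq> K \<and> (\<forall>i\<in>K. x i \<in> convex hull (x ` I)) \<and>
       convex hull (x ` (N - K)) \<inter> affine hull (x ` I) = {})"
    (is "?F face_of ?S \<longleftrightarrow> ?R")
proof
  assume face: "?F face_of ?S"
  define K where "K = {i \<in> N. x i \<in> ?F}"
  have "I \<subseteq> K" using assms by (auto simp: K_def hull_inc)
  have "x ` (N - K) \<subseteq> ?S - ?F" by (auto simp: K_def hull_inc)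
  then have "convex hull (x ` (N - K)) \<subseteq> ?S - ?F"
    by (intro hull_minimal convex_Diff_face_of face) auto
  moreover have "affine hull ?F \<inter> ?S = ?F"
    using face_of_imp_eq_affine_Int[OF _ face] convex_convex_hull by metis
  ultimately have "convex hull (x ` (N - K)) \<inter> affine hull (x ` I) = {}"
    by (auto simp: affine_hull_convex_hull)
  with \<open>I \<subseteq> K\<close> show ?R by (intro bexI[of _ K]) (auto simp: K_def)
next
  assume ?R
  then obtain K where K: "K \<subseteq> N" "I \<subseteq> K" "\<forall>i\<in>K. x i \<in> ?F"
    "convex hull (x ` (N - K)) \<inter> affine hull (x ` I) = {}" by blast
  have eq: "convex hull (x ` K) = ?F"
    using K by (intro antisym hull_minimal hull_mono) auto
  then have "affine hull (x ` K) = affine hull (x ` I)"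
    by (metis affine_hull_convex_hull)
  moreover have "convex hull (x ` N - x ` K) \<subseteq> convex hull (x ` (N - K))"
    by (intro hull_mono) auto
  ultimately have "convex hull (x ` K) face_of ?S"
    using K assms by (intro face_of_convex_hulls) auto
  then show "?F face_of ?S" by (simp add: eq)
qed

text \<open>A point off an affine hull raises the dimension by exactly one. Only membership in
  affine hulls remains, which again suits measurability.\<close>

lemma aff_dim_image_codim_one_iff:
  fixes x :: "'i \<Rightarrow> 'a::euclidean_space"
  assumes "I \<subseteq> N"
  shows "aff_dim (x ` I) = aff_dim (x ` N) - 1 \<longleftrightarrow>
    (\<exists>j\<in>N. x j \<notin> affine hull (x ` I) \<and> (\<forall>k\<in>N. x k \<in> affine hull (x ` insert j I)))"
proof
  assume eq: "aff_dim (x ` I) = aff_dim (x ` N) - 1"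
  have "\<exists>j\<in>N. x j \<notin> affine hull (x ` I)"
  proof (rule ccontr)
    assume "\<not> ?thesis"
    then have "x ` N \<subseteq> affine hull (x ` I)" by auto
    then have "aff_dim (x ` N) \<le> aff_dim (x ` I)" by (metis aff_dim_affine_hull aff_dim_subset)
    with eq show False by simp
  qed
  then obtain j where j: "j \<in> N" "x j \<notin> affine hull (x ` I)" by blast
  have "affine hull (x ` insert j I) = affine hull (x ` N)"
  proof (rule affine_dim_equal)
    show "affine hull (x ` insert j I) \<subseteq> affine hull (x ` N)"
      using j assms by (intro hull_mono) auto
    show "aff_dim (affine hull (x ` insert j I)) = aff_dim (affine hull (x ` N))"
      using eq j by (simp add: aff_dim_insert)
  qed auto
  with j show "\<exists>j\<in>N. x j \<notin> affine hull (x ` I) \<and> (\<forall>k\<in>N. x k \<in> affine hull (x ` insert j I))"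
    by (auto simp: hull_inc)
next
  assume "\<exists>j\<in>N. x j \<notin> affine hull (x ` I) \<and> (\<forall>k\<in>N. x k \<in> affine hull (x ` insert j I))"
  then obtain j where j: "j \<in> N" "x j \<notin> affine hull (x ` I)" "x ` N \<subseteq> affine hull (x ` insert j I)" by blast
  have "aff_dim (x ` N) \<le> aff_dim (x ` insert j I)"
    using j(3) by (metis aff_dim_affine_hull aff_dim_subset)
  moreover have "aff_dim (x ` insert j I) \<le> aff_dim (x ` N)"
    using j assms by (intro aff_dim_subset) auto
  ultimately show "aff_dim (x ` I) = aff_dim (x ` N) - 1"
    using j by (simp add: aff_dim_insert)
qed

text \<open>Since the probability space need not be complete, this has to hold for degenerate
  configurations too.\<close>

lemma pred_facet_event:
  fixes a :: "nat \<Rightarrow> 'w \<Rightarrow> 'a::euclidean_space"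
  assumes W: "subspace W" and a: "\<And>i. i \<in> {1..n} \<Longrightarrow> a i \<in> borel_measurable M"
    and I: "I \<subseteq> {1..n}"
  shows "Measurable.pred M (\<lambda>\<omega>. facet_event W n (\<lambda>i. a i \<omega>) I)"
proof -
  \<comment> \<open>\<open>W\<close> is written as the affine hull of 0 and a basis, enumerated by
    naturals to serve as a constant family \<open>g\<close>.\<close>
  obtain B where B: "finite B" "span B = W"
    using basis_exists[of W] W independent_imp_finite span_eq_iff by (metis span_subspace)
  obtain h :: "nat \<Rightarrow> 'a" and m where h: "insert 0 B = h ` {..<m}"
    using finite_imp_nat_seg_image_inj_on[of "insert 0 B"] B by (auto simp: lessThan_def)
  have Weq: "W = affine hull ((\<lambda>i. h i) ` {..<m})"
    using h B by (metis affine_hull_span_0 hull_inc insertI1 span_insert_0)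
  have finI: "finite I" using I finite_subset by blast
  \<comment> \<open>With a singleton on either side, \<open>?m\<close> says that a point belongs to
    a hull.\<close>
  let ?m = "\<lambda>\<omega> K J. convex hull ((\<lambda>i. a i \<omega>) ` K) \<inter> affine hull ((\<lambda>i. a i \<omega>) ` J) \<noteq> {}"
  have m: "Measurable.pred M (\<lambda>\<omega>. ?m \<omega> K J)" if "K \<subseteq> {1..n}" "J \<subseteq> {1..n}" for K J
    using that finite_subset[OF that(1)] finite_subset[OF that(2)]
    by (intro pred_convex_hull_meets_affine_hull a) auto
  have mW: "Measurable.pred M (\<lambda>\<omega>. convex hull ((\<lambda>i. a i \<omega>) ` I) \<inter> affine hull ((\<lambda>i. h i) ` {..<m}) \<noteq> {})"
    using I finI by (intro pred_convex_hull_meets_affine_hull[where g = "\<lambda>i \<omega>. h i"] a) auto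
  have iff: "facet_event W n (\<lambda>i. a i \<omega>) I \<longleftrightarrow>
     (\<exists>K\<in>{K\<in>Pow {1..n}. I \<subseteq> K}. (\<forall>i\<in>K. ?m \<omega> I {i}) \<and> \<not> ?m \<omega> ({1..n} - K) I) \<and>
     (\<exists>j\<in>{1..n}. \<not> ?m \<omega> {j} I \<and> (\<forall>k\<in>{1..n}. ?m \<omega> {k} (insert j I))) \<and>
     convex hull ((\<lambda>i. a i \<omega>) ` I) \<inter> affine hull ((\<lambda>i. h i) ` {..<m}) \<noteq> {}" for \<omega>
    unfolding facet_event_def facet_of_def aff_dim_convex_hull Weq[symmetric]
      convex_hull_face_of_convex_hull_iff[OF finite_atLeastAtMost I]
      aff_dim_image_codim_one_iff[OF I]
    by auto
  show ?thesis
    unfolding iff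
    using I finI
    by (intro pred_intros_logic pred_intros_finite m mW) (auto intro: finite_subset)
qed

section \<open>Random points almost surely avoid the affine hulls of others\<close>

lemma affine_hull_null_sets:
  fixes S :: "'a::euclidean_space set"
  assumes "finite S" "card S \<le> DIM('a)"
  shows "affine hull S \<in> null_sets lborel"
proof -
  have "aff_dim (affine hull S) \<noteq> int (DIM('a))"
    using aff_dim_le_card[OF assms(1)] assms(2) by simp
  then have "negligible (affine hull S)"
    by (simp add: negligible_convex_interior low_dim_interior affine_imp_convex)
  then show ?thesis
    by (simp add: negligible_iff_null_sets null_sets_completion_iff borel_closed closed_affine_hull)
qed

text \<open>For fixed positions of the points in \<open>J\<close> the affine hull is a null set,
  which a variable with a density avoids almost surely. By independence the joint law is a product,
  and Fubini's theorem applies.\<close>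

lemma (in prob_space) AE_notin_affine_hull:
  fixes a :: "nat \<Rightarrow> 'a \<Rightarrow> 'b::euclidean_space"
  assumes indep: "indep_vars (\<lambda>_. borel) a N" and i: "i \<in> N"
    and dens: "distributed M lborel (a i) f"
    and J: "J \<subseteq> N - {i}" "finite J" and A: "finite A" "card A + card J \<le> DIM('b)"
  shows "AE \<omega> in M. a i \<omega> \<notin> affine hull (A \<union> (\<lambda>j. a j \<omega>) ` J)"
proof -
  let ?S = "PiM J (\<lambda>_. borel :: 'b measure)" and ?X = "\<lambda>\<omega>. restrict (\<lambda>j. a j \<omega>) J"
  let ?T = "PiM {i} (\<lambda>_. borel :: 'b measure)" and ?Y = "\<lambda>\<omega>. restrict (\<lambda>j. a j \<omega>) {i}"
  have ind: "indep_var ?S ?X ?T ?Y"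
    using J i by (intro indep_var_restrict[OF indep]) auto
  note eq = ind[unfolded indep_var_distribution_eq]
  have X: "?X \<in> measurable M ?S" and Y: "?Y \<in> measurable M ?T" using eq by auto
  have ai: "a i \<in> measurable M lborel" using dens by (rule distributed_measurable)
  interpret D1: prob_space "distr M ?S ?X" using X by (rule prob_space_distr)
  interpret D2: prob_space "distr M ?T ?Y" using Y by (rule prob_space_distr)
  interpret P: pair_sigma_finite "distr M ?S ?X" "distr M ?T ?Y" ..
  let ?bad = "\<lambda>p. snd p i \<in> affine hull (A \<union> fst p ` J)"
  obtain h :: "nat \<Rightarrow> 'b" and m where h: "A = h ` {..<m}"
    using finite_imp_nat_seg_image_inj_on[OF A(1)] by (auto simp: lessThan_def)
  \<comment> \<open>A sum type joins the fixed points of \<open>A\<close> and the random points of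
    \<open>J\<close> into one family; the point \<open>a i\<close> is treated as a one-point convex
    hull.\<close>
  let ?L = "Inl ` {..<m} \<union> Inr ` J :: (nat + nat) set"
  let ?g = "\<lambda>l (p :: (nat \<Rightarrow> 'b) \<times> (nat \<Rightarrow> 'b)). case l of Inl k \<Rightarrow> h k | Inr j \<Rightarrow> fst p j"
  have "Measurable.pred (?S \<Otimes>\<^sub>M ?T) (\<lambda>p. convex hull ((\<lambda>_. snd p i) ` {()}) \<inter> affine hull ((\<lambda>l. ?g l p) ` ?L) \<noteq> {})"
  proof (rule pred_convex_hull_meets_affine_hull)
    show "?g l \<in> borel_measurable (?S \<Otimes>\<^sub>M ?T)" if "l \<in> ?L" for l
      using that by (auto intro!: measurable_compose[OF measurable_fst] measurable_component_singleton)
  qed (use J in \<open>auto intro!: measurable_compose[OF measurable_snd] measurable_component_singleton\<close>)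
  moreover have "(\<lambda>l. ?g l p) ` ?L = A \<union> fst p ` J" for p
    by (auto simp: h image_Un image_image)
  ultimately have bad: "Measurable.pred (?S \<Otimes>\<^sub>M ?T) ?bad"
    by simp
  have null: "AE q in distr M ?T ?Y. q i \<notin> affine hull (A \<union> y ` J)" for y
  proof -
    have "card (A \<union> y ` J) \<le> DIM('b)"
      using card_Un_le[of A "y ` J"] card_image_le[OF J(2), of y] A(2) by linarith
    then have "affine hull (A \<union> y ` J) \<in> null_sets lborel"
      using A J by (intro affine_hull_null_sets) auto
    then have "AE z in lborel. z \<notin> affine hull (A \<union> y ` J)" by (rule AE_not_in)
    then have "AE z in density lborel f. z \<notin> affine hull (A \<union> y ` J)"
      using distributed_borel_measurable[OF dens] by (auto simp: AE_density)
    then have "AE z in distr M lborel (a i). z \<notin> affine hull (A \<union> y ` J)"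
      unfolding distributed_distr_eq_density[OF dens] .
    moreover have cl: "affine hull (A \<union> y ` J) \<in> sets borel" by (simp add: borel_closed closed_affine_hull)
    ultimately have "AE \<omega> in M. a i \<omega> \<notin> affine hull (A \<union> y ` J)"
      using ai by (subst (asm) AE_distr_iff) (auto simp: Collect_neg_eq)
    moreover have "{q \<in> space ?T. q i \<notin> affine hull (A \<union> y ` J)} \<in> sets ?T"
    proof -
      have "(\<lambda>q. q i) -` (- (affine hull (A \<union> y ` J))) \<inter> space ?T \<in> sets ?T"
      proof (rule measurable_sets[where A = borel])
        show "(\<lambda>q. q i) \<in> measurable ?T borel" by (rule measurable_component_singleton) simp
        show "- (affine hull (A \<union> y ` J)) \<in> sets borel" by (rule borel_comp[OF cl])
      qed
      moreover have "(\<lambda>q. q i) -` (- (affine hull (A \<union> y ` J))) \<inter> space ?T = {q \<in> space ?T. q i \<notin> affine hull (A \<union> y ` J)}"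
        by auto
      ultimately show ?thesis by simp
    qed
    ultimately show ?thesis
      using Y by (subst AE_distr_iff) auto
  qed
  have "{p \<in> space (?S \<Otimes>\<^sub>M ?T). \<not> ?bad p} \<in> sets (?S \<Otimes>\<^sub>M ?T)"
    using bad by (simp add: pred_def)
  note nbad = this
  have "AE p in distr M ?S ?X \<Otimes>\<^sub>M distr M ?T ?Y. \<not> ?bad p"
  proof (rule P.AE_pair_measure)
    show "AE x in distr M ?S ?X. AE y in distr M ?T ?Y. \<not> ?bad (x, y)"
      using null by simp
    show "{x \<in> space (distr M ?S ?X \<Otimes>\<^sub>M distr M ?T ?Y). \<not> ?bad x} \<in> sets (distr M ?S ?X \<Otimes>\<^sub>M distr M ?T ?Y)"
      using nbad by (simp add: space_pair_measure cong: sets_pair_measure_cong)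
  qed
  then have "AE p in distr M (?S \<Otimes>\<^sub>M ?T) (\<lambda>\<omega>. (?X \<omega>, ?Y \<omega>)). \<not> ?bad p"
    using eq by metis
  then have "AE \<omega> in M. \<not> ?bad (?X \<omega>, ?Y \<omega>)"
    using X Y nbad by (subst (asm) AE_distr_iff) auto
  moreover have "?X \<omega> ` J = (\<lambda>j. a j \<omega>) ` J" for \<omega> by auto
  ultimately show ?thesis by simp
qed

section \<open>The expected number of edges\<close>

lemma (in prob_space) AE_generic_points:
  fixes a :: "nat \<Rightarrow> 'a \<Rightarrow> 'b::euclidean_space"
  assumes indep: "indep_vars (\<lambda>_. borel) a {1..n}"
    and dens: "\<And>i. i \<in> {1..n} \<Longrightarrow> \<exists>f. distributed M lborel (a i) f"
  shows "AE \<omega> in M. generic_points u n (\<lambda>i. a i \<omega>)"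
proof -
  have "AE \<omega> in M. card A + card J \<le> DIM('b) \<longrightarrow> a i \<omega> \<notin> affine hull (A \<union> (\<lambda>j. a j \<omega>) ` J)"
    if A: "A \<in> {{}, {0}, {0, u}}" and i: "i \<in> {1..n}" and J: "J \<in> Pow ({1..n} - {i})" for A i J
  proof (cases "card A + card J \<le> DIM('b)")
    case True
    obtain f where "distributed M lborel (a i) f" using dens[OF i] by blast
    moreover have "finite A" "finite J" "J \<subseteq> {1..n} - {i}" using A J by (auto intro: finite_subset)
    ultimately show ?thesis using AE_notin_affine_hull[OF indep i, of f J A] True by simp
  qed simp
  then show ?thesis
    unfolding generic_points_def by (intro AE_finite_allI) auto
qed

lemma nn_integral_card_eq_sum_emeasure:
  assumes "finite A" "\<And>i. i \<in> A \<Longrightarrow> E i \<in> sets M"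
  shows "(\<integral>\<^sup>+ \<omega>. of_nat (card {i \<in> A. \<omega> \<in> E i}) \<partial>M) = (\<Sum>i\<in>A. emeasure M (E i))"
proof -
  have "(of_nat (card {i \<in> A. \<omega> \<in> E i}) :: ennreal) = (\<Sum>i\<in>A. indicator (E i) \<omega>)" for \<omega>
    using assms(1) by (simp add: indicator_def sum.If_cases Int_def)
  then have "(\<integral>\<^sup>+ \<omega>. of_nat (card {i \<in> A. \<omega> \<in> E i}) \<partial>M) = (\<integral>\<^sup>+ \<omega>. (\<Sum>i\<in>A. indicator (E i) \<omega>) \<partial>M)"
    by simp
  also have "\<dots> = (\<Sum>i\<in>A. emeasure M (E i))"
    using assms by (subst nn_integral_sum) auto
  finally show ?thesis .
qed

text \<open>The weight \<open>\<mu>\<close> is left free, so that Jensen's inequality for the square root reduces to the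
  choice of \<open>\<mu>\<close>.\<close>

lemma expected_edges_le:
  fixes M :: "'w measure" and a :: "nat \<Rightarrow> 'w \<Rightarrow> 'b::euclidean_space"
  assumes M: "prob_space M" and n: "n \<ge> 1" and W: "oriented_plane W u v"
    and \<gamma>: "\<gamma> > 0" and \<mu>: "\<mu> > 0"
    and indep: "prob_space.indep_vars M (\<lambda>_. borel) a {1..n}"
    and dens: "\<And>i. i \<in> {1..n} \<Longrightarrow> \<exists>f. distributed M lborel (a i) f"
    and gap: "\<And>I. I \<subseteq> {1..n} \<Longrightarrow> card I = DIM('b) \<Longrightarrow>
           \<P>(\<omega> in M. facet_event W n (\<lambda>i. a i \<omega>) I) \<ge> 10 / real (n choose DIM('b)) \<Longrightarrow>
           \<P>(\<omega> in M. next_vertex_gap W u v n (\<lambda>i. a i \<omega>) I \<gamma>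
                \<bar> facet_event W n (\<lambda>i. a i \<omega>) I) \<ge> 1 / 10"
  shows "(\<integral>\<^sup>+ \<omega>. of_nat (edges (convex hull ((\<lambda>i. a i \<omega>) ` {1..n}) \<inter> W)) \<partial>M)
     \<le> 10 + 10 * (ennreal (4 * \<mu>) + ennreal (4 / (\<gamma> * \<mu>)) *
           (\<integral>\<^sup>+ \<omega>. ennreal (MAX i\<in>{1..n}. norm (orth_proj W (a i \<omega>))) \<partial>M))"
    (is "?X \<le> 10 + 10 * (_ + _ * (\<integral>\<^sup>+ \<omega>. ennreal (?R \<omega>) \<partial>M))")
proof -
  interpret prob_space M by (rule M)
  have W': "subspace W" "dim W = 2" "u \<in> W" "u \<noteq> 0" using W by (auto simp: oriented_plane_def)
  have meas: "a i \<in> borel_measurable M" if "i \<in> {1..n}" for i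
    using indep that by (auto simp: indep_vars_def)
  have gen: "AE \<omega> in M. generic_points u n (\<lambda>i. a i \<omega>)"
    using AE_generic_points[OF indep dens] .
  show ?thesis
  \<comment> \<open>At most \<open>DIM('b)\<close> points give at most one edge, well within the
    summand 10. Beyond that the binomial coefficient is positive.\<close>
  proof (cases "n \<le> DIM('b)")
    case True
    have "?X \<le> (\<integral>\<^sup>+ \<omega>. 1 \<partial>M)"
    proof (rule nn_integral_mono_AE)
      show "AE \<omega> in M. of_nat (edges (convex hull ((\<lambda>i. a i \<omega>) ` {1..n}) \<inter> W)) \<le> (1::ennreal)"
        using gen
      proof eventually_elim
        case (elim \<omega>)
        then have "edges (convex hull ((\<lambda>i. a i \<omega>) ` {1..n}) \<inter> W) \<le> 1"
          using generic_points_small_edges_le W' True by blast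
        then show ?case by (metis of_nat_1 of_nat_mono)
      qed
    qed
    also have "\<dots> \<le> 10 + 0" by (simp add: emeasure_space_1)
    also have "\<dots> \<le> 10 + 10 * (ennreal (4 * \<mu>) + ennreal (4 / (\<gamma> * \<mu>)) * (\<integral>\<^sup>+ \<omega>. ennreal (?R \<omega>) \<partial>M))"
      by (intro add_left_mono) simp
    finally show ?thesis .
  next
    case False
    define \<I> where "\<I> = {I. I \<subseteq> {1..n} \<and> card I = DIM('b)}"
    define E where "E I = {\<omega> \<in> space M. facet_event W n (\<lambda>i. a i \<omega>) I}" for I
    define G where "G I = {\<omega> \<in> space M. next_vertex_gap W u v n (\<lambda>i. a i \<omega>) I \<gamma> \<and>
        facet_event W n (\<lambda>i. a i \<omega>) I}" for I
    \<comment> \<open>The gap event is not assumed measurable; \<open>G' I\<close> is a measurable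
      substitute, which agrees with \<open>G I\<close> whenever the gap hypothesis is
      applied.\<close>
    define G' where "G' I = (if G I \<in> sets M then G I else {})" for I
    let ?C = "n choose DIM('b)"
    have fin: "finite \<I>" unfolding \<I>_def by (rule finite_subset[of _ "Pow {1..n}"]) auto
    have card\<I>: "card \<I> = ?C" unfolding \<I>_def using n_subsets[of "{1..n}" "DIM('b)"] by simp
    have C0: "?C > 0" using False by simp
    have E: "E I \<in> sets M" if "I \<in> \<I>" for I
      using pred_facet_event[where a = a and n = n and I = I, OF W'(1) meas] that unfolding \<I>_def E_def pred_def by auto
    have G': "G' I \<in> sets M" for I by (simp add: G'_def)
    have "?X \<le> (\<integral>\<^sup>+ \<omega>. of_nat (card {I \<in> \<I>. \<omega> \<in> E I}) \<partial>M)"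
    proof (rule nn_integral_mono_AE)
      show "AE \<omega> in M. of_nat (edges (convex hull ((\<lambda>i. a i \<omega>) ` {1..n}) \<inter> W))
          \<le> (of_nat (card {I \<in> \<I>. \<omega> \<in> E I}) :: ennreal)"
        using gen AE_space
      proof eventually_elim
        case (elim \<omega>)
        have "{I \<in> \<I>. \<omega> \<in> E I} = {I. I \<subseteq> {1..n} \<and> card I = DIM('b) \<and> facet_event W n (\<lambda>i. a i \<omega>) I}"
          using elim by (auto simp: \<I>_def E_def)
        then show ?case
          using generic_points_edges_le[OF elim(1) W'(4) _ W'(1,2)] False by (simp add: of_nat_mono)
      qed
    qed
    also have "\<dots> = (\<Sum>I\<in>\<I>. emeasure M (E I))"
      by (rule nn_integral_card_eq_sum_emeasure[OF fin E])
    \<comment> \<open>An improbable \<open>I\<close> is charged to the first term, and these terms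
      sum to 10 over all \<open>?C\<close> index sets; any other \<open>I\<close> is charged to the
      second by the gap hypothesis.\<close>
    also have "\<dots> \<le> (\<Sum>I\<in>\<I>. ennreal (10 / real ?C) + 10 * emeasure M (G' I))"
    proof (rule sum_mono)
      fix I assume I: "I \<in> \<I>"
      show "emeasure M (E I) \<le> ennreal (10 / real ?C) + 10 * emeasure M (G' I)"
      proof (cases "prob (E I) \<ge> 10 / real ?C")
        case True
        then have pos: "prob (E I) > 0" using C0 by (auto intro: less_le_trans[rotated])
        have "cond_prob M (\<lambda>\<omega>. next_vertex_gap W u v n (\<lambda>i. a i \<omega>) I \<gamma>)
            (\<lambda>\<omega>. facet_event W n (\<lambda>i. a i \<omega>) I) \<ge> 1 / 10"
          using gap[of I] I True by (simp add: \<I>_def E_def)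
        then have ge: "prob (G I) / prob (E I) \<ge> 1 / 10"
          by (simp add: cond_prob_def G_def E_def)
        \<comment> \<open>non-measurable sets have measure 0, so the gap event is measurable here\<close>
        then have "G I \<in> sets M" using pos measure_notin_sets[of "G I" M] by fastforce
        moreover have "prob (E I) \<le> 10 * prob (G I)" using ge pos by (simp add: field_simps)
        ultimately have "ennreal (prob (E I)) \<le> ennreal (10 * prob (G' I))"
          by (intro ennreal_leI) (simp add: G'_def)
        also have "\<dots> = 10 * emeasure M (G' I)"
          by (simp add: emeasure_eq_measure ennreal_mult)
        finally show ?thesis
          by (simp add: emeasure_eq_measure[of "E I"] add_increasing)
      next
        case False
        then have "emeasure M (E I) \<le> ennreal (10 / real ?C)"
          unfolding emeasure_eq_measure by (intro ennreal_leI) simp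
        then show ?thesis by (simp add: add_increasing2)
      qed
    qed
    also have "\<dots> = of_nat (card \<I>) * ennreal (10 / real ?C) + 10 * (\<Sum>I\<in>\<I>. emeasure M (G' I))"
      by (simp add: sum.distrib sum_distrib_left)
    also have "of_nat (card \<I>) * ennreal (10 / real ?C) = 10"
      unfolding card\<I> using C0
      by (subst ennreal_of_nat_eq_real_of_nat, subst ennreal_mult[symmetric]) (auto simp del: binomial_eq_0_iff)
    also have "(\<Sum>I\<in>\<I>. emeasure M (G' I)) = (\<integral>\<^sup>+ \<omega>. of_nat (card {I \<in> \<I>. \<omega> \<in> G' I}) \<partial>M)"
      by (rule nn_integral_card_eq_sum_emeasure[OF fin G', symmetric])
    also have "\<dots> \<le> (\<integral>\<^sup>+ \<omega>. ennreal (4 * \<mu>) + ennreal (4 / (\<gamma> * \<mu>)) * ennreal (?R \<omega>) \<partial>M)"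
    proof (rule nn_integral_mono_AE)
      show "AE \<omega> in M. of_nat (card {I \<in> \<I>. \<omega> \<in> G' I}) \<le> ennreal (4 * \<mu>) + ennreal (4 / (\<gamma> * \<mu>)) * ennreal (?R \<omega>)"
        using gen
      proof eventually_elim
        case (elim \<omega>)
        have "norm (orth_proj W (a 1 \<omega>)) \<le> ?R \<omega>" using n by (intro Max_ge) auto
        then have R0: "?R \<omega> \<ge> 0" using norm_ge_zero order_trans by blast
        let ?A = "{I. I \<subseteq> {1..n} \<and> card I = DIM('b) \<and> facet_event W n (\<lambda>i. a i \<omega>) I \<and>
            next_vertex_gap W u v n (\<lambda>i. a i \<omega>) I \<gamma>}"
        have "{I \<in> \<I>. \<omega> \<in> G' I} \<subseteq> ?A" by (auto simp: \<I>_def G'_def G_def split: if_splits)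
        moreover have "finite ?A" by (rule finite_subset[OF _ fin]) (auto simp: \<I>_def)
        ultimately have "real (card {I \<in> \<I>. \<omega> \<in> G' I}) \<le> real (card ?A)" by (simp add: card_mono)
        also have "\<dots> \<le> 4 * \<mu> + 4 * ?R \<omega> / (\<gamma> * \<mu>)"
          by (rule card_gap_facets_le[OF elim W n \<gamma> \<mu>])
        finally have "ennreal (real (card {I \<in> \<I>. \<omega> \<in> G' I})) \<le> ennreal (4 * \<mu> + 4 / (\<gamma> * \<mu>) * ?R \<omega>)"
          by (intro ennreal_leI) simp
        also have "\<dots> = ennreal (4 * \<mu>) + ennreal (4 / (\<gamma> * \<mu>) * ?R \<omega>)"
          using \<gamma> \<mu> R0 by (intro ennreal_plus) auto
        also have "ennreal (4 / (\<gamma> * \<mu>) * ?R \<omega>) = ennreal (4 / (\<gamma> * \<mu>)) * ennreal (?R \<omega>)"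
          using \<gamma> \<mu> R0 by (intro ennreal_mult) auto
        finally show ?case by (simp add: ennreal_of_nat_eq_real_of_nat)
      qed
    qed
    also have "\<dots> = ennreal (4 * \<mu>) + ennreal (4 / (\<gamma> * \<mu>)) * (\<integral>\<^sup>+ \<omega>. ennreal (?R \<omega>) \<partial>M)"
    proof -
      have "(\<lambda>\<omega>. norm (orth_proj W (a i \<omega>))) \<in> borel_measurable M" if "i \<in> {1..n}" for i
        unfolding orth_proj_oriented_plane[OF W] using meas[OF that] by measurable
      then have R: "?R \<in> borel_measurable M" by (intro borel_measurable_Max) auto
      have "(\<integral>\<^sup>+ \<omega>. ennreal (4 * \<mu>) + ennreal (4 / (\<gamma> * \<mu>)) * ennreal (?R \<omega>) \<partial>M)
          = (\<integral>\<^sup>+ \<omega>. ennreal (4 * \<mu>) \<partial>M) + (\<integral>\<^sup>+ \<omega>. ennreal (4 / (\<gamma> * \<mu>)) * ennreal (?R \<omega>) \<partial>M)"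
        using R by (intro nn_integral_add) auto
      also have "(\<integral>\<^sup>+ \<omega>. ennreal (4 / (\<gamma> * \<mu>)) * ennreal (?R \<omega>) \<partial>M)
          = ennreal (4 / (\<gamma> * \<mu>)) * (\<integral>\<^sup>+ \<omega>. ennreal (?R \<omega>) \<partial>M)"
        using R by (intro nn_integral_cmult) auto
      finally show ?thesis by (simp add: emeasure_space_1)
    qed
    finally show ?thesis by (simp add: add_left_mono mult_left_mono)
  qed
qed

section \<open>Choice of the weight and the final bound\<close>

theorem mainTheorem5:
  fixes M :: "'w measure"
    and a :: "nat \<Rightarrow> 'w \<Rightarrow> real ^ 'd"
    and W :: "(real ^ 'd) set"
    and u v :: "real ^ 'd"
    and n :: nat
    and \<gamma> :: real
  assumes "prob_space M"
    and "n \<ge> 2"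
    and "CARD('d) \<ge> 2"
    and "oriented_plane W u v"
    and "\<gamma> > 0"
    and "prob_space.indep_vars M (\<lambda>_. borel) a {1..n}"
    and "\<And>i. i \<in> {1..n} \<Longrightarrow> \<exists>f. distributed M lborel (a i) f"
    and "\<And>I. I \<subseteq> {1..n} \<Longrightarrow> card I = CARD('d) \<Longrightarrow>
           \<P>(\<omega> in M. facet_event W n (\<lambda>i. a i \<omega>) I) \<ge> 10 / real (n choose CARD('d)) \<Longrightarrow>
           \<P>(\<omega> in M. next_vertex_gap W u v n (\<lambda>i. a i \<omega>) I \<gamma>
                \<bar> facet_event W n (\<lambda>i. a i \<omega>) I) \<ge> 1 / 10"
  shows "(\<integral>\<^sup>+ \<omega>. of_nat (edges (convex hull ((\<lambda>i. a i \<omega>) ` {1..n}) \<inter> W)) \<partial>M)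
         \<le> 10 + 80 * ennreal pi *
             esqrt ((\<integral>\<^sup>+ \<omega>. ennreal (MAX i\<in>{1..n}. norm (orth_proj W (a i \<omega>))) \<partial>M) / ennreal \<gamma>)"
    (is "?X \<le> 10 + 80 * ennreal pi * esqrt (?r / ennreal \<gamma>)")
proof (cases "?r = \<infinity>")
  case True
  then have "?r / ennreal \<gamma> = \<infinity>"
    using \<open>\<gamma> > 0\<close> by (simp add: ennreal_top_divide)
  then have "80 * ennreal pi * esqrt (?r / ennreal \<gamma>) = \<infinity>"
    by (simp add: esqrt_def ennreal_mult_top)
  then show ?thesis by simp
next
  case False
  then obtain r where r: "r \<ge> 0" "?r = ennreal r" by (cases ?r) auto
  define m where "m = r / \<gamma>"
  have m0: "m \<ge> 0" using r \<open>\<gamma> > 0\<close> by (simp add: m_def)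
  have bound: "?X \<le> ennreal (10 + 40 * \<mu> + 40 * m / \<mu>)" if \<mu>: "\<mu> > 0" for \<mu>
  proof -
    have "?X \<le> 10 + 10 * (ennreal (4 * \<mu>) + ennreal (4 / (\<gamma> * \<mu>)) * ?r)"
      using assms \<mu> by (intro expected_edges_le) auto
    also have "ennreal (4 / (\<gamma> * \<mu>)) * ?r = ennreal (4 * m / \<mu>)"
      unfolding r(2) using r(1) \<mu> \<open>\<gamma> > 0\<close> by (simp add: m_def field_simps flip: ennreal_mult)
    also have "ennreal (4 * \<mu>) + ennreal (4 * m / \<mu>) = ennreal (4 * \<mu> + 4 * m / \<mu>)"
      using \<mu> m0 by simp
    also have "10 + 10 * ennreal (4 * \<mu> + 4 * m / \<mu>) = ennreal (10 + 40 * \<mu> + 40 * m / \<mu>)"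
    proof -
      have "10 * ennreal (4 * \<mu> + 4 * m / \<mu>) = ennreal (40 * \<mu> + 40 * m / \<mu>)"
        using \<mu> m0 by (subst ennreal_numeral[symmetric], subst ennreal_mult[symmetric]) (auto simp: algebra_simps)
      moreover have "ennreal 10 + ennreal (40 * \<mu> + 40 * m / \<mu>) = ennreal (10 + (40 * \<mu> + 40 * m / \<mu>))"
        using \<mu> m0 by (intro ennreal_plus[symmetric]) auto
      ultimately show ?thesis by (simp add: add.assoc)
    qed
    finally show ?thesis .
  qed
  have "?X \<le> ennreal (10 + 80 * sqrt m)"
  proof (cases "m = 0")
    case True
    \<comment> \<open>For \<open>m = 0\<close> no positive weight is optimal, so the weight tends to
      0: \<open>e / 40\<close> leaves an excess of \<open>e\<close>.\<close>
    have "?X \<le> 10"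
    proof (rule ennreal_le_epsilon)
      fix e :: real assume "e > 0"
      then have "?X \<le> ennreal (10 + 40 * (e / 40) + 40 * m / (e / 40))" by (intro bound) simp
      also have "\<dots> = 10 + ennreal e" using True \<open>e > 0\<close> by (simp add: ennreal_plus)
      finally show "?X \<le> 10 + ennreal e" .
    qed
    then show ?thesis using True by simp
  next
    case False
    \<comment> \<open>The weight \<open>sqrt m\<close> balances the two terms, each being
      \<open>40 * sqrt m\<close>.\<close>
    then have "sqrt m > 0" using m0 by simp
    moreover have "10 + 40 * sqrt m + 40 * m / sqrt m = 10 + 80 * sqrt m"
      using real_div_sqrt[OF m0] by (simp flip: times_divide_eq_right)
    ultimately show ?thesis using bound[of "sqrt m"] by metis
  qed
  \<comment> \<open>The axis-parallel length bounds lead to the constant 80, which is enlarged to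
    the stated \<open>80 * pi\<close>.\<close>
  also have "\<dots> \<le> ennreal (10 + 80 * pi * sqrt m)"
  proof (intro ennreal_leI add_left_mono mult_right_mono)
    show "80 \<le> 80 * pi" using pi_gt3 by simp
  qed (use m0 in simp)
  also have "\<dots> = 10 + 80 * ennreal pi * ennreal (sqrt m)"
    using m0 by (simp add: ennreal_plus ennreal_mult)
  also have "ennreal (sqrt m) = esqrt (?r / ennreal \<gamma>)"
    unfolding r(2) using r(1) m0 \<open>\<gamma> > 0\<close> by (simp add: divide_ennreal esqrt_def m_def)
  finally show ?thesis .
qed

end
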